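(* Let $\varphi\in\operatorname{LFM}(B_N)$ be elliptic. Suppose that $(\varphi,B_N)$ is conjugated to $(\psi,B_N)$, where $$\psi(z',z'')=(\Lambda z',A_1z''),\qquad (z',z'')\in(\mathbb{C}^{u}\times\mathbb{C}^{N-u})\cap B_N,$$ with $\Lambda$ a diagonal unitary matrix of order $u$ and $A_1$ a square matrix of order $N-u$ with $\rho(A_1)<1$ and $\|A_1\|\le 1$. Then there is a semigroup $\{\varphi_t\}$ of linear fractional maps on $B_N$ such that $\varphi_1=\varphi$ if and only if there is a dissipative matrix $M$ with $\sigma(M)\subset\{\lambda\in\mathbb{C}:\operatorname{Re}\lambda\le 0\}$ such that $$\exp(M)=A_1.$$
   Context: $B_N$ is the open unit ball of $\mathbb{C}^N$. A holomorphic map is linear fractional if it has the form $z\mapsto \frac{Az+B}{\langle z,C\rangle+D}$ with $A\in\mathbb{C}^{N\times N}$, $B,C\in\mathbb{C}^N$, $D\in\mathbb{C}$, where $\langle z,w\rangle=w^Hz$; $\operatorname{LFM}(B_N)$ is the set of linear fractional self-maps of $B_N$. A holomorphic self-map of $B_N$ is elliptic if it has at least one fixed point in $B_N$. For holomorphic self-maps $\psi:D\to D$ and $\psi':D'\to D'$ of domains in $\mathbb{C}^N$, $(\psi,D)$ and $(\psi',D')$ are conjugated if there is a biholomorphic map $\sigma:D\to D'$ with $\psi=\sigma^{-1}\circ\psi'\circ\sigma$. A (continuous) semigroup $\{\varphi_t\}_{t\ge0}$ on a domain $D$ is a continuous homomorphism from the additive semigroup of non-negative reals into the composition semigroup of holomorphic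 self-maps of $D$ with the compact-open topology (so $\varphi_0=\mathrm{id}$, $\varphi_{t+s}=\varphi_t\circ\varphi_s$); it is a semigroup of linear fractional maps if every $\varphi_t$ is linear fractional. For a square matrix, $\sigma(\cdot)$ is the spectrum, $\rho(\cdot)$ the spectral radius, $\|\cdot\|$ the spectral norm, $\exp$ the matrix exponential, and $^H$ the conjugate transpose. A square matrix $M$ is dissipative if $\operatorname{Re}(w^HMw)\le0$ for every complex vector $w$. Here $u$ is an integer with $1\le u\le N$. *)

theory Defs
  imports "HOL-Analysis.Analysis" "Jordan_Normal_Form.Spectral_Radius"
    "Jordan_Normal_Form.Schur_Decomposition"
begin

text \<open>
  Holomorphic maps live on the type \<^typ>\<open>complex^'n\<close>, with \<open>N = CARD('n)\<close>. The matrices of order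
  \<open>u\<close> and \<open>N - u\<close> are matrices of the Jordan normal form library, because their orders are numbers
  and \<open>N - u\<close> may be \<open>0\<close>. Self-maps of a set \<open>D\<close> are total functions of which only the values
  on \<open>D\<close> matter.
\<close>

no_notation vec_nth (infixl "$" 90)
notation vec_nth (infixl "$h" 90)
hide_const (open) Finite_Cartesian_Product.vec
hide_type (open) Finite_Cartesian_Product.vec


subsection \<open>Holomorphic maps\<close>

definition holo_on :: "(complex^'n \<Rightarrow> complex^'n) \<Rightarrow> (complex^'n) set \<Rightarrow> bool" where
  "holo_on f D \<longleftrightarrow>
     (\<forall>z\<in>D. \<exists>f'. (f has_derivative f') (at z) \<and> (\<forall>c v. f' (c *s v) = c *s f' v))"

definition Hol :: "(complex^'n) set \<Rightarrow> (complex^'n \<Rightarrow> complex^'n) set" where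
  "Hol D = {f. holo_on f D \<and> f ` D \<subseteq> D}"

definition biholomorphic ::
  "(complex^'n \<Rightarrow> complex^'n) \<Rightarrow> (complex^'n) set \<Rightarrow> (complex^'n) set \<Rightarrow> bool" where
  "biholomorphic \<sigma> D D' \<longleftrightarrow> bij_betw \<sigma> D D' \<and> holo_on \<sigma> D \<and> holo_on (inv_into D \<sigma>) D'"

definition conjugated ::
  "(complex^'n \<Rightarrow> complex^'n) \<Rightarrow> (complex^'n) set \<Rightarrow>
   (complex^'n \<Rightarrow> complex^'n) \<Rightarrow> (complex^'n) set \<Rightarrow> bool" where
  "conjugated \<psi> D \<psi>' D' \<longleftrightarrow>
     (\<exists>\<sigma>. biholomorphic \<sigma> D D' \<and> (\<forall>z\<in>D. \<psi> z = (inv_into D \<sigma> \<circ> \<psi>' \<circ> \<sigma>) z))"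

definition compact_open :: "(complex^'n) set \<Rightarrow> (complex^'n \<Rightarrow> complex^'n) topology" where
  "compact_open D =
     topology_generated_by {{f \<in> Hol D. f ` K \<subseteq> V} | K V. compact K \<and> K \<subseteq> D \<and> open V}"

definition semigroup_on :: "(complex^'n) set \<Rightarrow> (real \<Rightarrow> complex^'n \<Rightarrow> complex^'n) \<Rightarrow> bool" where
  "semigroup_on D \<phi> \<longleftrightarrow>
     (\<forall>t\<ge>0. \<phi> t \<in> Hol D) \<and>
     (\<forall>z\<in>D. \<phi> 0 z = z) \<and>
     (\<forall>t\<ge>0. \<forall>s\<ge>0. \<forall>z\<in>D. \<phi> (t + s) z = (\<phi> t \<circ> \<phi> s) z) \<and>
     continuous_map (top_of_set {0..}) (compact_open D) \<phi>"

definition elliptic :: "(complex^'n \<Rightarrow> complex^'n) \<Rightarrow> bool" where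
  "elliptic \<phi> \<longleftrightarrow> (\<exists>z\<in>ball 0 1. \<phi> z = z)"


subsection \<open>Linear fractional maps of the ball\<close>

definition herm :: "complex^'n \<Rightarrow> complex^'n \<Rightarrow> complex" where
  "herm z w = (\<Sum>i\<in>UNIV. z $h i * cnj (w $h i))"

definition LFM :: "(complex^'n \<Rightarrow> complex^'n) set" where
  "LFM = {\<phi> \<in> Hol (ball 0 1). \<exists>(A :: complex^'n^'n) (B :: complex^'n) (C :: complex^'n) (D :: complex).
     \<forall>z\<in>ball 0 1. herm z C + D \<noteq> 0 \<and> \<phi> z = inverse (herm z C + D) *s (A *v z + B)}"


subsection \<open>Matrices\<close>

text \<open>The library's \<^const>\<open>spectral_radius\<close> is an unspecified maximum over the empty set for the
  matrix of order \<open>0\<close>; the value there is fixed to be \<open>0\<close>.\<close>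

definition rho :: "complex mat \<Rightarrow> real" where
  "rho A = (if dim_row A = 0 then 0 else spectral_radius A)"

definition vec_norm2 :: "complex Matrix.vec \<Rightarrow> real" where
  "vec_norm2 v = L2_set (\<lambda>i. cmod (v $ i)) {..<dim_vec v}"

definition spectral_norm :: "complex mat \<Rightarrow> real" where
  "spectral_norm A = Sup {vec_norm2 (A *\<^sub>v v) | v. v \<in> carrier_vec (dim_col A) \<and> vec_norm2 v \<le> 1}"

definition mat_exp :: "complex mat \<Rightarrow> complex mat" where
  "mat_exp M = Matrix.mat (dim_row M) (dim_row M) (\<lambda>(i,j). \<Sum>k. (M ^\<^sub>m k) $$ (i,j) / fact k)"

definition unitary_mat :: "complex mat \<Rightarrow> bool" where
  "unitary_mat A \<longleftrightarrow> square_mat A \<and> mat_adjoint A * A = 1\<^sub>m (dim_row A)"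

text \<open>Here \<open>(M *\<^sub>v w) \<bullet>c w\<close> is \<open>w\<^sup>H M w\<close>, since \<open>\<bullet>c\<close> conjugates its second argument.\<close>

definition dissipative :: "complex mat \<Rightarrow> bool" where
  "dissipative M \<longleftrightarrow> square_mat M \<and> (\<forall>w \<in> carrier_vec (dim_row M). Re ((M *\<^sub>v w) \<bullet>c w) \<le> 0)"


subsection \<open>Coordinates\<close>

text \<open>An enumeration \<open>e\<close> of the index type by \<open>0, \<dots>, N - 1\<close> identifies \<^typ>\<open>complex^'n\<close> with the
  column vectors of length \<open>N\<close>; it gives a meaning to ``the first \<open>u\<close> coordinates''.\<close>

definition to_coords :: "(nat \<Rightarrow> 'n) \<Rightarrow> complex^'n \<Rightarrow> complex Matrix.vec" where
  "to_coords e z = Matrix.vec CARD('n) (\<lambda>i. z $h e i)"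

definition of_coords :: "(nat \<Rightarrow> 'n) \<Rightarrow> complex Matrix.vec \<Rightarrow> complex^'n" where
  "of_coords e v = (\<chi> k. v $ inv_into {..<CARD('n)} e k)"

definition split_map ::
  "(nat \<Rightarrow> 'n) \<Rightarrow> nat \<Rightarrow> complex mat \<Rightarrow> complex mat \<Rightarrow> complex^'n \<Rightarrow> complex^'n" where
  "split_map e u \<Lambda> A z =
     of_coords e ((\<Lambda> *\<^sub>v vec_first (to_coords e z) u) @\<^sub>v
                  (A *\<^sub>v vec_last (to_coords e z) (CARD('n) - u)))"

end

theory Submission
  imports Defs "HOL-Complex_Analysis.Conformal_Mappings"
begin

text \<open>Every automorphism of the ball is a Moebius involution composed with a unitary map: after moving
  the image of \<open>0\<close> to \<open>0\<close>, equality holds in the Schwarz lemma on each complex line. Hence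
  conjugation preserves linear fractional self-maps, and a dissipative logarithm \<open>M\<close> of \<open>A\<^sub>1\<close> gives the
  semigroup conjugate to the contractions \<open>\<Lambda>\<^sup>t \<oplus> exp (t M)\<close>.

  Conversely, the orbit under \<open>\<Phi>\<close> of a fixed point of \<open>\<phi> = \<Phi> 1\<close> is periodic, and its hyperbolic
  circumcentre \<open>q\<close> is a common fixed point. In suitable coordinates \<open>q\<close> becomes \<open>0\<close> and \<open>\<phi>\<close> becomes
  the linear map \<open>\<Lambda> \<oplus> A\<^sub>1\<close>, so the derivatives at \<open>0\<close> form a contraction semigroup \<open>B\<close> through
  \<open>B 1 = \<Lambda> \<oplus> A\<^sub>1\<close>. As \<open>B t\<close> commutes with \<open>B 1\<close> and \<open>A\<^sub>1\<close> has no eigenvalue of modulus \<open>1\<close>, each \<open>B t\<close>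
  is block triangular; the lower block of its dissipative generator is the logarithm of \<open>A\<^sub>1\<close>.\<close>


subsection \<open>The matrix exponential\<close>

text \<open>The point of the criterion is dissipativity: an invertible \<open>A\<^sub>1\<close>
  always has logarithms, but \<open>M\<close> must make \<open>exp (t M)\<close> a contraction for
  every real \<open>t \<ge> 0\<close>, not only for integers. The obstacle in the converse is that a
  fixed point of \<phi> may move under \<Phi>: if \<Lambda> has the eigenvalue 1, the fixed points
  of \<phi> are not isolated. The circumcentre helps because it depends only on the set traced by
  the orbit and on a distance that holomorphic self-maps do not increase. Recentring there must not
  spoil the linear form. It does not: the new centre lies in the fixed space of \<Lambda> and has
  vanishing last coordinates, so the Moebius involution about it commutes with \<Lambda> \<oplus>
  \<open>A\<^sub>1\<close>. Triangularity is enough at the end: a vanishing lower left block makes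
  compression to the last coordinates multiplicative, and compressing a dissipative matrix keeps it
  dissipative.\<close>

lemma index_mult_mat_sum:
  assumes "A \<in> carrier_mat m n" "B \<in> carrier_mat n p" "i < m" "j < p"
  shows "(A * B) $$ (i,j) = (\<Sum>l<n. A $$ (i,l) * B $$ (l,j))"
  using assms by (auto simp: scalar_prod_def lessThan_atLeast0 intro!: sum.cong)

lemma index_mult_mat_vec_sum:
  assumes "A \<in> carrier_mat m n" "v \<in> carrier_vec n" "i < m"
  shows "(A *\<^sub>v v) $ i = (\<Sum>l<n. A $$ (i,l) * v $ l)"
  using assms by (auto simp: scalar_prod_def lessThan_atLeast0 intro!: sum.cong)

lemma cscalar_prod_sum:
  fixes v w :: "complex Matrix.vec"
  assumes "v \<in> carrier_vec n" "w \<in> carrier_vec n"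
  shows "v \<bullet>c w = (\<Sum>i<n. v $ i * cnj (w $ i))"
  using assms by (auto simp: scalar_prod_def lessThan_atLeast0 intro!: sum.cong)

lemma smult_smult: "a \<cdot>\<^sub>m (b \<cdot>\<^sub>m A) = (a * b :: complex) \<cdot>\<^sub>m A"
  by (intro eq_matI) auto

context
  fixes M :: "complex mat" and n :: nat
  assumes M: "M \<in> carrier_mat n n"
begin

lemma smult_one: "1 \<cdot>\<^sub>m M = M"
  by (intro eq_matI) auto

lemma pow_mat_Suc_left: "M ^\<^sub>m Suc k = M * M ^\<^sub>m k"
proof (induction k)
  case (Suc k)
  have "M ^\<^sub>m Suc (Suc k) = (M * M ^\<^sub>m k) * M" using Suc by simp
  also have "\<dots> = M * M ^\<^sub>m Suc k" using M by (simp add: assoc_mult_mat[of _ n n _ n _ n])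
  finally show ?case .
qed (use M in simp)

lemma pow_mat_smult: "(c \<cdot>\<^sub>m M) ^\<^sub>m k = c ^ k \<cdot>\<^sub>m M ^\<^sub>m k"
proof (induction k)
  case (Suc k)
  have "M ^\<^sub>m k \<in> carrier_mat n n" using M by simp
  then have "(c ^ k \<cdot>\<^sub>m M ^\<^sub>m k) * (c \<cdot>\<^sub>m M) = c ^ k \<cdot>\<^sub>m (c \<cdot>\<^sub>m (M ^\<^sub>m k * M))"
    using M by (metis mult_smult_assoc_mat mult_smult_distrib smult_carrier_mat)
  then show ?case by (simp add: Suc smult_smult mult.commute)
qed (use M in \<open>auto\<close>)

text \<open>By induction the entries of the k-th power are at most \<open>(n c) ^ k\<close>, with
  \<open>c\<close> the sum of all entry moduli, so the exponential series dominates. Keeping the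
  scalar \<open>z\<close> outside the matrix makes every entry an everywhere convergent power
  series, which may be differentiated termwise.\<close>

lemma summable_mat_exp:
  assumes ij: "i < n" "j < n"
  shows "summable (\<lambda>k. (M ^\<^sub>m k) $$ (i,j) / fact k * z ^ k)"
proof -
  define c where "c = (\<Sum>(i,j)\<in>{..<n} \<times> {..<n}. cmod (M $$ (i,j)))"
  have c0: "0 \<le> c" by (auto simp: c_def sum_nonneg)
  have c: "cmod (M $$ (i,j)) \<le> c" if "i < n" "j < n" for i j
    unfolding c_def using member_le_sum[of "(i,j)" "{..<n} \<times> {..<n}" "\<lambda>(i,j). cmod (M $$ (i,j))"] that
    by auto
  have pow: "cmod ((M ^\<^sub>m k) $$ (i,j)) \<le> (real n * c) ^ k" if "i < n" "j < n" for i j k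
    using that(2)
  proof (induction k arbitrary: j)
    case (Suc k)
    have "cmod ((M ^\<^sub>m Suc k) $$ (i,j)) = cmod (\<Sum>l<n. (M ^\<^sub>m k) $$ (i,l) * M $$ (l,j))"
      using index_mult_mat_sum[of "M ^\<^sub>m k" n n M n i j] M that Suc.prems by simp
    also have "\<dots> \<le> (\<Sum>l<n. (real n * c) ^ k * c)"
      by (intro sum_norm_le) (auto simp: norm_mult intro!: mult_mono Suc.IH c Suc.prems c0 zero_le_power mult_nonneg_nonneg)
    finally show ?case by (simp add: mult_ac)
  qed (use M that in \<open>auto simp: one_mat_def\<close>)
  show ?thesis
  proof (rule summable_comparison_test')
    show "summable (\<lambda>k. (real n * c * norm z) ^ k /\<^sub>R fact k)" by (rule summable_exp_generic)
    show "norm ((M ^\<^sub>m k) $$ (i,j) / fact k * z ^ k) \<le> (real n * c * norm z) ^ k /\<^sub>R fact k" for k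
      using mult_right_mono[OF pow[OF ij, of k], of "norm z ^ k"]
      by (simp add: norm_mult norm_divide norm_power power_mult_distrib divide_simps)
  qed
qed

lemma mat_exp_carrier [simp]: "mat_exp (c \<cdot>\<^sub>m M) \<in> carrier_mat n n"
  using M by (simp add: mat_exp_def)

lemma mat_exp_smult_index:
  assumes "i < n" "j < n"
  shows "mat_exp (c \<cdot>\<^sub>m M) $$ (i,j) = (\<Sum>k. (M ^\<^sub>m k) $$ (i,j) / fact k * c ^ k)"
  using assms M by (simp add: mat_exp_def pow_mat_smult mult.commute)

lemma mat_exp_0: "mat_exp (0 \<cdot>\<^sub>m M) = 1\<^sub>m n"
proof (rule eq_matI)
  fix i j assume "i < dim_row (1\<^sub>m n)" "j < dim_col (1\<^sub>m n)"
  then show "mat_exp (0 \<cdot>\<^sub>m M) $$ (i,j) = 1\<^sub>m n $$ (i,j)"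
    using M powser_zero[of "\<lambda>k. (M ^\<^sub>m k) $$ (i,j) / fact k"] by (simp add: mat_exp_smult_index)
qed (use M in \<open>auto simp: mat_exp_def\<close>)

lemma mat_exp_field_derivative:
  assumes ij: "i < n" "j < n"
  shows "((\<lambda>z. mat_exp (z \<cdot>\<^sub>m M) $$ (i,j)) has_field_derivative
           (\<Sum>k. (M ^\<^sub>m Suc k) $$ (i,j) / fact k * z ^ k)) (at z)"
proof -
  have "diffs (\<lambda>k. (M ^\<^sub>m k) $$ (i,j) / fact k) = (\<lambda>k. (M ^\<^sub>m Suc k) $$ (i,j) / fact k)"
    by (auto simp: diffs_def field_simps simp del: pow_mat.simps of_nat_Suc)
  with termdiffs_strong_converges_everywhere[OF summable_mat_exp[OF ij], of z]
  show ?thesis by (simp only: mat_exp_smult_index[OF ij])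
qed

text \<open>The two forms come from splitting off the extra factor of the (k+1)-st power on the left
  or on the right. The left form differentiates the exponential inside a product; the right form
  makes the exponential itself a solution of \<open>D' = D M\<close>.\<close>

lemma mat_exp_derivative:
  assumes ij: "i < n" "j < n"
  shows "((\<lambda>t. mat_exp (of_real t \<cdot>\<^sub>m M) $$ (i,j)) has_vector_derivative
           (M * mat_exp (of_real t \<cdot>\<^sub>m M)) $$ (i,j)) (at t within S)" (is ?L)
    and "((\<lambda>t. mat_exp (of_real t \<cdot>\<^sub>m M) $$ (i,j)) has_vector_derivative
           (mat_exp (of_real t \<cdot>\<^sub>m M) * M) $$ (i,j)) (at t within S)" (is ?R)
proof -
  have car: "M ^\<^sub>m k \<in> carrier_mat n n" for k using M by simp
  let ?z = "of_real t :: complex"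
  note sm = summable_mat_exp
  have "(\<Sum>k. (M ^\<^sub>m Suc k) $$ (i,j) / fact k * ?z ^ k)
      = (\<Sum>k. \<Sum>l<n. M $$ (i,l) * ((M ^\<^sub>m k) $$ (l,j) / fact k * ?z ^ k))"
    unfolding pow_mat_Suc_left index_mult_mat_sum[OF M car ij]
    by (simp add: sum_divide_distrib sum_distrib_right mult.assoc)
  also have "\<dots> = (\<Sum>l<n. \<Sum>k. M $$ (i,l) * ((M ^\<^sub>m k) $$ (l,j) / fact k * ?z ^ k))"
    using sm ij by (intro suminf_sum summable_mult) auto
  also have "\<dots> = (M * mat_exp (?z \<cdot>\<^sub>m M)) $$ (i,j)"
    unfolding index_mult_mat_sum[OF M mat_exp_carrier ij]
    using sm ij by (intro sum.cong refl) (subst suminf_mult, auto simp: mat_exp_smult_index)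
  finally show ?L
    using has_vector_derivative_real_field[OF mat_exp_field_derivative[OF ij, of ?z]] by simp
  have "(\<Sum>k. (M ^\<^sub>m Suc k) $$ (i,j) / fact k * ?z ^ k)
      = (\<Sum>k. \<Sum>l<n. ((M ^\<^sub>m k) $$ (i,l) / fact k * ?z ^ k) * M $$ (l,j))"
    unfolding pow_mat.simps index_mult_mat_sum[OF car M ij]
    by (simp add: sum_divide_distrib sum_distrib_left sum_distrib_right mult_ac)
  also have "\<dots> = (\<Sum>l<n. \<Sum>k. ((M ^\<^sub>m k) $$ (i,l) / fact k * ?z ^ k) * M $$ (l,j))"
    using sm ij by (intro suminf_sum summable_mult2) auto
  also have "\<dots> = (mat_exp (?z \<cdot>\<^sub>m M) * M) $$ (i,j)"
    unfolding index_mult_mat_sum[OF mat_exp_carrier M ij]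
    using sm ij by (intro sum.cong refl) (subst suminf_mult2[symmetric], auto simp: mat_exp_smult_index)
  finally show ?R
    using has_vector_derivative_real_field[OF mat_exp_field_derivative[OF ij, of ?z]] by simp
qed

text \<open>The product \<open>D r * exp ((c - r) M)\<close> is constant, because the two terms
  \<open>D M E\<close> of its derivative cancel. Derivatives are one-sided at 0 since the semigroups
  live on \<open>{0..}\<close>. Taking \<open>c = t\<close> gives uniqueness, and taking
  \<open>D\<close> to be the exponential gives its functional equation.\<close>

lemma ode_mat_exp:
  assumes D: "\<And>t. 0 \<le> t \<Longrightarrow> D t \<in> carrier_mat n n"
    and D': "\<And>t i j. 0 \<le> t \<Longrightarrow> i < n \<Longrightarrow> j < n \<Longrightarrow>
      ((\<lambda>t. D t $$ (i,j)) has_vector_derivative (D t * M) $$ (i,j)) (at t within {0..})"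
    and t: "0 \<le> (t::real)"
  shows "D t * mat_exp (of_real (c - t) \<cdot>\<^sub>m M) = D 0 * mat_exp (of_real c \<cdot>\<^sub>m M)"
proof -
  define E where "E r = mat_exp (of_real r \<cdot>\<^sub>m M)" for r :: real
  have E: "E r \<in> carrier_mat n n" for r by (simp add: E_def)
  have "D t * E (c - t) = D 0 * E (c - 0)"
  proof (rule eq_matI)
    fix i j assume "i < dim_row (D 0 * E (c - 0))" "j < dim_col (D 0 * E (c - 0))"
    then have ij: "i < n" "j < n" using D[of 0] E[of c] by auto
    define F where "F r = (\<Sum>l<n. D r $$ (i,l) * E (c - r) $$ (l,j))" for r
    have F: "(D r * E (c - r)) $$ (i,j) = F r" if "0 \<le> r" for r
      unfolding F_def using index_mult_mat_sum[OF D E] that ij by blast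
    have "(F has_vector_derivative 0) (at r within {0..})" if r: "r \<in> {0..}" for r
    proof -
      have r0: "0 \<le> r" using r by simp
      have dE: "((\<lambda>r. E (c - r) $$ (l,j)) has_vector_derivative - (M * E (c - r)) $$ (l,j)) (at r within {0..})"
        if "l < n" for l
      proof -
        have "((\<lambda>r. c - r) has_vector_derivative - 1) (at r within {0..})"
          by (auto intro!: derivative_eq_intros)
        moreover have "((\<lambda>r. E r $$ (l,j)) has_vector_derivative (M * E (c - r)) $$ (l,j))
            (at (c - r) within (\<lambda>r. c - r) ` {0..})"
          unfolding E_def by (rule mat_exp_derivative(1)[OF that ij(2)])
        ultimately have "((\<lambda>r. E r $$ (l,j)) \<circ> (\<lambda>r. c - r) has_vector_derivative
            - 1 *\<^sub>R (M * E (c - r)) $$ (l,j)) (at r within {0..})"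
          by (rule vector_diff_chain_within)
        then show ?thesis by (simp only: o_def scaleR_minus_left scaleR_one)
      qed
      have "(F has_vector_derivative
          (\<Sum>l<n. D r $$ (i,l) * - (M * E (c - r)) $$ (l,j) + (D r * M) $$ (i,l) * E (c - r) $$ (l,j)))
          (at r within {0..})"
        unfolding F_def using ij r0
        by (intro has_vector_derivative_sum has_vector_derivative_mult D' dE) auto
      also have "(\<Sum>l<n. D r $$ (i,l) * - (M * E (c - r)) $$ (l,j) + (D r * M) $$ (i,l) * E (c - r) $$ (l,j))
          = ((D r * M) * E (c - r)) $$ (i,j) - (D r * (M * E (c - r))) $$ (i,j)"
        unfolding index_mult_mat_sum[OF mult_carrier_mat[OF D[OF r0] M] E ij]
          index_mult_mat_sum[OF D[OF r0] mult_carrier_mat[OF M E] ij]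
        by (simp add: sum.distrib sum_negf sum_subtractf)
      also have "\<dots> = 0" using D[OF r0] M E[of "c - r"] by (simp add: assoc_mult_mat[of _ n n _ n _ n])
      finally show ?thesis .
    qed
    then obtain K where "\<And>r. r \<in> {0..} \<Longrightarrow> F r = K"
      using has_vector_derivative_zero_constant[of "{0::real..}" F] by auto
    then have "F t = F 0" using t by auto
    then show "(D t * E (c - t)) $$ (i,j) = (D 0 * E (c - 0)) $$ (i,j)"
      using F[OF t] F[OF order_refl] by simp
  qed (use D[of 0] D[of t] t E[of c] E[of "c - t"] in auto)
  then show ?thesis by (simp add: E_def)
qed

lemma ode_mat_exp_unique:
  assumes "\<And>t. 0 \<le> t \<Longrightarrow> D t \<in> carrier_mat n n"
    and "\<And>t i j. 0 \<le> t \<Longrightarrow> i < n \<Longrightarrow> j < n \<Longrightarrow>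
      ((\<lambda>t. D t $$ (i,j)) has_vector_derivative (D t * M) $$ (i,j)) (at t within {0..})"
    and "D 0 = 1\<^sub>m n"
  shows "D 1 = mat_exp M"
  using ode_mat_exp[of D 1 1, OF assms(1,2)] assms(1)[of 1] assms(3) mat_exp_0 M mat_exp_carrier[of 1]
    smult_one
  by auto

lemma mat_exp_add:
  assumes "0 \<le> t"
  shows "mat_exp (of_real (t + s) \<cdot>\<^sub>m M) = mat_exp (of_real t \<cdot>\<^sub>m M) * mat_exp (of_real s \<cdot>\<^sub>m M)"
  using ode_mat_exp[of "\<lambda>t. mat_exp (of_real t \<cdot>\<^sub>m M)" t "t + s", OF _ mat_exp_derivative(2) assms]
    left_mult_one_mat[OF mat_exp_carrier, of "of_real t + of_real s"] mat_exp_0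
  by auto

text \<open>The squared norm of \<open>w r = exp (r M) v\<close> has the derivative
  \<open>2 Re (w^H M w)\<close>, which dissipativity makes nonpositive.\<close>

lemma mat_exp_contraction:
  assumes diss: "dissipative M" and v: "v \<in> carrier_vec n" and t: "0 \<le> t"
  shows "(\<Sum>i<n. (cmod ((mat_exp (of_real t \<cdot>\<^sub>m M) *\<^sub>v v) $ i))\<^sup>2) \<le> (\<Sum>i<n. (cmod (v $ i))\<^sup>2)"
proof -
  define w where "w r = mat_exp (of_real r \<cdot>\<^sub>m M) *\<^sub>v v" for r :: real
  have w: "w r \<in> carrier_vec n" for r using mult_mat_vec_carrier[OF mat_exp_carrier v] by (simp add: w_def)
  have w': "((\<lambda>r. w r $ i) has_vector_derivative (M *\<^sub>v w r) $ i) (at r)" if "i < n" for i r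
  proof -
    have "((\<lambda>r. \<Sum>l<n. mat_exp (of_real r \<cdot>\<^sub>m M) $$ (i,l) * v $ l) has_vector_derivative
        (\<Sum>l<n. (M * mat_exp (of_real r \<cdot>\<^sub>m M)) $$ (i,l) * v $ l)) (at r)"
      using that by (intro has_vector_derivative_sum has_vector_derivative_mult_left mat_exp_derivative) auto
    moreover have "(\<Sum>l<n. (M * mat_exp (of_real r \<cdot>\<^sub>m M)) $$ (i,l) * v $ l) = (M *\<^sub>v w r) $ i"
      unfolding w_def using assoc_mult_mat_vec[OF M mat_exp_carrier v]
        index_mult_mat_vec_sum[OF mult_carrier_mat[OF M mat_exp_carrier] v that] by metis
    moreover have "(\<lambda>r. \<Sum>l<n. mat_exp (of_real r \<cdot>\<^sub>m M) $$ (i,l) * v $ l) = (\<lambda>r. w r $ i)"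
      unfolding w_def using index_mult_mat_vec_sum[OF mat_exp_carrier v that] by auto
    ultimately show ?thesis by metis
  qed
  define q where "q r = (\<Sum>i<n. inner (w r $ i) (w r $ i))" for r
  have q': "(q has_real_derivative 2 * Re ((M *\<^sub>v w r) \<bullet>c w r)) (at r)" for r
  proof -
    have "(q has_derivative (\<lambda>h. \<Sum>i<n. inner (w r $ i) (h *\<^sub>R (M *\<^sub>v w r) $ i)
        + inner (h *\<^sub>R (M *\<^sub>v w r) $ i) (w r $ i))) (at r)"
      unfolding q_def using w'[unfolded has_vector_derivative_def]
      by (intro has_derivative_sum has_derivative_inner) auto
    also have "(\<lambda>h. \<Sum>i<n. inner (w r $ i) (h *\<^sub>R (M *\<^sub>v w r) $ i)
        + inner (h *\<^sub>R (M *\<^sub>v w r) $ i) (w r $ i)) = (\<lambda>h. h * (2 * Re ((M *\<^sub>v w r) \<bullet>c w r)))"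
      using cscalar_prod_sum[OF mult_mat_vec_carrier[OF M w] w, of r r]
      by (auto simp: inner_complex_def sum_distrib_left algebra_simps intro!: sum.cong)
    finally show ?thesis
      by (simp add: has_field_derivative_def mult_commute_abs)
  qed
  have "Re ((M *\<^sub>v w r) \<bullet>c w r) \<le> 0" for r
    using diss w[of r] M by (auto simp: dissipative_def)
  then have "q t \<le> q 0"
    using q' t by (intro DERIV_nonpos_imp_nonincreasing[of 0 t q]) (auto intro!: exI simp: mult_nonneg_nonpos)
  moreover have "w 0 = v" using v by (simp add: w_def mat_exp_0)
  ultimately show ?thesis by (simp add: q_def w_def dot_square_norm)
qed

text \<open>Testing the form on an eigenvector \<open>v\<close> gives
  \<open>Re c * |v|^2 \<le> 0\<close>.\<close>

lemma dissipative_spectrum: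
  assumes diss: "dissipative M"
  shows "spectrum M \<subseteq> {c. Re c \<le> 0}"
proof
  fix c assume "c \<in> spectrum M"
  then obtain v where v: "v \<in> carrier_vec n" "v \<noteq> 0\<^sub>v n" "M *\<^sub>v v = c \<cdot>\<^sub>v v"
    using M by (auto simp: spectrum_def eigenvalue_def eigenvector_def)
  have "(M *\<^sub>v v) \<bullet>c v = c * of_real (\<Sum>i<n. (cmod (v $ i))\<^sup>2)"
    unfolding v(3) using v(1) by (subst cscalar_prod_sum[of _ n])
      (auto simp: sum_distrib_left complex_norm_square mult.assoc of_real_sum simp del: of_real_power)
  then have "Re c * (\<Sum>i<n. (cmod (v $ i))\<^sup>2) \<le> 0"
    using diss v(1) M by (force simp: dissipative_def)
  moreover have "\<exists>k<n. v $ k \<noteq> 0"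
  proof (rule ccontr)
    assume "\<not> (\<exists>k<n. v $ k \<noteq> 0)"
    then have "v = 0\<^sub>v n" using v(1) by (intro eq_vecI) auto
    with v(2) show False ..
  qed
  then obtain k where "k < n" "v $ k \<noteq> 0" by blast
  then have "(\<Sum>i<n. (cmod (v $ i))\<^sup>2) > 0" by (intro sum_pos2[of _ k]) auto
  ultimately show "c \<in> {c. Re c \<le> 0}" by (simp add: mult_le_0_iff)
qed

end


subsection \<open>The Hermitian form and the Moebius involutions of the ball\<close>

lemma herm_linear [simp]:
  "herm (x + y) w = herm x w + herm y w" "herm (x - y) w = herm x w - herm y w"
  "herm (c *s x) w = c * herm x w" "herm 0 w = 0" "herm (- x) w = - herm x w"
  by (simp_all add: herm_def sum.distrib sum_subtractf sum_distrib_left sum_negf algebra_simps)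

lemma herm_antilinear [simp]:
  "herm w (x + y) = herm w x + herm w y" "herm w (x - y) = herm w x - herm w y"
  "herm w (c *s x) = cnj c * herm w x" "herm w 0 = 0" "herm w (- x) = - herm w x"
  by (simp_all add: herm_def sum.distrib sum_subtractf sum_distrib_left sum_negf algebra_simps)

lemma cnj_herm: "cnj (herm z w) = herm w z"
  by (simp add: herm_def mult.commute)

lemma herm_self: "herm z z = of_real ((norm z)\<^sup>2)"
  by (simp add: herm_def norm_vec_def L2_set_def sum_nonneg flip: complex_norm_square)

lemma norm_smult_vec [simp]: "norm (c *s (z :: complex^'n)) = cmod c * norm z"
proof -
  have "of_real ((norm (c *s z))\<^sup>2) = (of_real ((cmod c * norm z)\<^sup>2) :: complex)"
    unfolding herm_self[symmetric] of_real_mult power_mult_distrib complex_norm_square by simp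
  then have "(norm (c *s z))\<^sup>2 = (cmod c * norm z)\<^sup>2"
    by (simp only: of_real_eq_iff)
  then show ?thesis by (simp add: power2_eq_iff_nonneg)
qed

text \<open>Pythagoras for the projection onto the line of \<open>w\<close>. It yields both the
  Cauchy-Schwarz inequality and its equality case.\<close>

lemma norm_diff_herm_projection:
  assumes "norm w = 1"
  shows "(norm (z - herm z w *s w))\<^sup>2 = (norm z)\<^sup>2 - (cmod (herm z w))\<^sup>2"
proof -
  have w: "herm w w = 1" using assms by (simp add: herm_self)
  have "of_real ((norm (z - herm z w *s w))\<^sup>2) = herm z z - herm z w * cnj (herm z w)"
    unfolding herm_self[symmetric] by (simp add: w cnj_herm algebra_simps)
  also have "\<dots> = of_real ((norm z)\<^sup>2 - (cmod (herm z w))\<^sup>2)"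
    by (simp only: herm_self complex_norm_square of_real_diff)
  finally show ?thesis by (simp only: of_real_eq_iff)
qed

lemma herm_eq_norm_imp:
  assumes "norm w = 1" "cmod (herm z w) = norm z"
  shows "z = herm z w *s w"
  using norm_diff_herm_projection[OF assms(1), of z] assms(2) by simp

lemma norm_herm_le: "cmod (herm z w) \<le> norm z * norm w"
proof (cases "w = 0")
  case False
  define v where "v = of_real (1 / norm w) *s w"
  have v: "norm v = 1" using False by (simp add: v_def norm_divide)
  have "(cmod (herm z v))\<^sup>2 \<le> (norm z)\<^sup>2"
    using norm_diff_herm_projection[OF v, of z] by (smt (verit) zero_le_power2)
  then have "cmod (herm z v) \<le> norm z" by (simp add: power2_le_iff_abs_le)
  then show ?thesis using False by (simp add: v_def norm_mult norm_divide field_simps)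
qed simp

lemma herm_scaleR [simp]: "herm (r *\<^sub>R z) w = r *\<^sub>R herm z w" "herm w (r *\<^sub>R z) = r *\<^sub>R herm w z"
  by (simp_all add: herm_def scaleR_sum_right)

lemma bounded_linear_herm: "bounded_linear (\<lambda>z. herm z w)"
  by (rule bounded_linear_intro[where K = "norm w"]) (simp_all add: norm_herm_le)

lemma bounded_linear_herm_right: "bounded_linear (herm w)"
  by (rule bounded_linear_intro[where K = "norm w"])
     (simp_all add: norm_herm_le mult.commute[of "norm _" "norm w"])

lemmas continuous_on_herm_left = bounded_linear.continuous_on[OF bounded_linear_herm]

text \<open>The involution \<open>(a - P z - s Q z) / (1 - herm z a)\<close>, with \<open>P\<close>
  the orthogonal projection onto the line of \<open>a\<close> and \<open>Q = 1 - P\<close>. Since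
  \<open>|a|^2 = 1 - s^2\<close>, the coefficient \<open>(1 - s) / |a|^2\<close> of
  \<open>herm z a\<close> equals \<open>1 / (1 + s)\<close>; this form also covers
  \<open>a = 0\<close>, where the map is \<open>z \<mapsto> - z\<close>.\<close>

definition ball_moebius :: "complex^'n \<Rightarrow> complex^'n \<Rightarrow> complex^'n" where
  "ball_moebius a z = (let s = of_real (sqrt (1 - (norm a)\<^sup>2)) in
     inverse (1 - herm z a) *s ((1 - herm z a / (1 + s)) *s a - s *s z))"

lemma norm_herm_ball: "z \<in> ball 0 1 \<Longrightarrow> w \<in> ball 0 1 \<Longrightarrow> cmod (herm z w) < 1"
  using norm_herm_le[of z w] by simp (smt (verit) mult_less_cancel_left2 mult_nonneg_nonneg norm_ge_zero mult_left_le)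

lemma one_minus_herm_ne: "z \<in> ball 0 1 \<Longrightarrow> w \<in> ball 0 1 \<Longrightarrow> 1 - herm z w \<noteq> 0"
  using norm_herm_ball[of z w] by auto

text \<open>A symmetric invariant of two points of the ball that equals 1 exactly when they coincide
  and decreases with their distance. Lower bounds on \<open>kappa\<close> are therefore upper bounds
  on distances.\<close>

definition kappa :: "complex^'n \<Rightarrow> complex^'n \<Rightarrow> real" where
  "kappa c x = (1 - (norm c)\<^sup>2) * (1 - (norm x)\<^sup>2) / (cmod (1 - herm x c))\<^sup>2"

context
  fixes a z :: "complex^'n"
  assumes a: "a \<in> ball 0 1" and z: "z \<in> ball 0 1"
begin

text \<open>Expanding the numerator leaves \<open>|a|^2 = 1 - s^2\<close> multiplied by
  \<open>k = 1 / (1 + s)\<close>; the relation \<open>k (1 - s^2) = 1 - s\<close> removes all mixed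
  terms and leaves \<open>s^2 (1 - |z|^2)\<close>.\<close>

lemma one_minus_norm_ball_moebius: "1 - (norm (ball_moebius a z))\<^sup>2 = kappa a z"
proof -
  define s :: complex where "s = of_real (sqrt (1 - (norm a)\<^sup>2))"
  have na: "(norm a)\<^sup>2 < 1" using a by (simp add: power_less_one_iff abs_square_less_1)
  have rs: "sqrt (1 - (norm a)\<^sup>2) > 0" using na by simp
  have "1 + s = of_real (1 + sqrt (1 - (norm a)\<^sup>2))" by (simp add: s_def)
  moreover have "1 + sqrt (1 - (norm a)\<^sup>2) \<noteq> 0" using rs by linarith
  ultimately have s1: "1 + s \<noteq> 0" by (simp only: of_real_eq_0_iff not_False_eq_True)
  have s2: "s\<^sup>2 = 1 - of_real ((norm a)\<^sup>2)"
    unfolding s_def of_real_power[symmetric] using na by (simp del: of_real_power)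
  define x where "x = herm z a"
  define y where "y = cnj x"
  have y: "herm a z = y" by (simp add: y_def x_def cnj_herm)
  define k where "k = 1 / (1 + s)"
  have k: "k * (1 + s) = 1" using s1 by (simp add: k_def)
  have "k * (1 - s\<^sup>2) = (k * (1 + s)) * (1 - s)" by (simp add: algebra_simps power2_eq_square)
  then have k2: "k * (1 - s\<^sup>2) = 1 - s" by (simp add: k)
  have cs: "cnj s = s" and ck: "cnj k = k" by (simp_all add: s_def k_def)
  define n where "n = (1 - x * k) *s a - s *s z"
  have d: "1 - x \<noteq> 0" "1 - y \<noteq> 0" using one_minus_herm_ne[OF z a] one_minus_herm_ne[OF a z]
    by (auto simp: x_def y)
  have m: "ball_moebius a z = inverse (1 - x) *s n"
    by (simp add: ball_moebius_def s_def x_def n_def k_def Let_def)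
  have "herm n n = (1 - x*k)*(1-y*k) * herm a a - (1 - x*k) * s * y - (1-y*k) * s * x + s * s * herm z z"
    by (simp add: n_def y x_def[symmetric] cs ck y_def[symmetric] algebra_simps)
  moreover have "herm a a = 1 - s\<^sup>2" by (simp add: s2 herm_self)
  ultimately have "herm n n = (1 - s\<^sup>2) - (x + y) * (k * (1 - s\<^sup>2)) + x * y * k * (k * (1 - s\<^sup>2))
      - s * (x + y) + 2 * x * y * k * s + s\<^sup>2 * herm z z"
    by (simp add: algebra_simps power2_eq_square)
  also have "\<dots> = (1 - s\<^sup>2) - (x + y) + x * y * (k * (1 + s)) + s\<^sup>2 * herm z z"
    unfolding k2 by (simp add: algebra_simps)
  finally have e: "(1 - x)*(1-y) - herm n n = s\<^sup>2 * (1 - herm z z)"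
    unfolding k by (simp add: algebra_simps)
  have "of_real (1 - (norm (ball_moebius a z))\<^sup>2) = 1 - herm (ball_moebius a z) (ball_moebius a z)"
    by (simp add: herm_self)
  also have "\<dots> = ((1 - x)*(1-y) - herm n n) / ((1-x)*(1-y))"
  proof -
    have "herm (ball_moebius a z) (ball_moebius a z) = herm n n / ((1-x)*(1-y))"
      by (simp add: m y_def[symmetric] divide_inverse)
    then show ?thesis using d by (simp add: diff_divide_distrib)
  qed
  also have "\<dots> = s\<^sup>2 * (1 - herm z z) / ((1-x)*cnj (1-x))" using e by (simp add: y_def)
  also have "\<dots> = of_real (kappa a z)"
    unfolding complex_norm_square[symmetric] by (simp add: kappa_def s2 herm_self x_def)
  finally show ?thesis by (simp only: of_real_eq_iff)
qed

lemma kappa_pos: "kappa a z > 0"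
  using a z one_minus_herm_ne[OF z a] by (auto simp: kappa_def power_less_one_iff abs_square_less_1 intro!: divide_pos_pos mult_pos_pos)

lemma ball_moebius_in_ball: "ball_moebius a z \<in> ball 0 1"
  using kappa_pos abs_square_less_1[of "norm (ball_moebius a z)"] by (simp flip: one_minus_norm_ball_moebius)

text \<open>The key relation is \<open>(1 - y) * (1 - x) = s\<^sup>2\<close> for the denominators of
  the two applications; after multiplying by them, each coordinate reduces to that of
  \<open>z\<close>.\<close>

lemma ball_moebius_ball_moebius: "ball_moebius a (ball_moebius a z) = z"
proof -
  define s :: complex where "s = of_real (sqrt (1 - (norm a)\<^sup>2))"
  have na: "(norm a)\<^sup>2 < 1" using a by (simp add: power_less_one_iff abs_square_less_1)
  have rs: "sqrt (1 - (norm a)\<^sup>2) > 0" using na by simp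
  have s0: "s \<noteq> 0" unfolding s_def using rs by simp
  have "1 + s = of_real (1 + sqrt (1 - (norm a)\<^sup>2))" by (simp add: s_def)
  moreover have "1 + sqrt (1 - (norm a)\<^sup>2) \<noteq> 0" using rs by linarith
  ultimately have s1: "1 + s \<noteq> 0" by (simp only: of_real_eq_0_iff not_False_eq_True)
  have s2: "s\<^sup>2 = 1 - of_real ((norm a)\<^sup>2)"
    unfolding s_def of_real_power[symmetric] using na by (simp del: of_real_power)
  define x where "x = herm z a"
  define k where "k = 1 / (1 + s)"
  have k: "k * (1 + s) = 1" using s1 by (simp add: k_def)
  have "k * (1 - s\<^sup>2) = (k * (1 + s)) * (1 - s)" by (simp add: algebra_simps power2_eq_square)
  then have k2: "k * (1 - s\<^sup>2) = 1 - s" by (simp add: k)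
  have d: "1 - x \<noteq> 0" using one_minus_herm_ne[OF z a] by (auto simp: x_def)
  define w where "w = ball_moebius a z"
  have m: "w = inverse (1 - x) *s ((1 - x * k) *s a - s *s z)"
    by (simp add: w_def ball_moebius_def s_def x_def k_def Let_def)
  have aa: "herm a a = 1 - s\<^sup>2" by (simp add: s2 herm_self)
  define y where "y = herm w a"
  have y: "y * (1 - x) = (1 - x * k) * (1 - s\<^sup>2) - s * x"
    using d by (simp add: y_def m aa x_def[symmetric] divide_simps) (simp add: algebra_simps)
  have "(1 - x * k) * (1 - s\<^sup>2) = (1 - s\<^sup>2) - x * (k * (1 - s\<^sup>2))" by (simp add: algebra_simps)
  then have y': "y * (1 - x) = 1 - s\<^sup>2 - x" unfolding k2 y by (simp add: algebra_simps)
  have "(1 - y) * (1 - x) = (1 - x) - y * (1 - x)" by (simp add: algebra_simps)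
  then have y1: "(1 - y) * (1 - x) = s\<^sup>2" unfolding y' by simp
  have y0: "1 - y \<noteq> 0" using y1 s0 by auto
  have "ball_moebius a w = inverse (1 - y) *s ((1 - y * k) *s a - s *s w)"
    by (simp add: ball_moebius_def s_def y_def k_def Let_def)
  also have "\<dots> = z"
  proof (subst Finite_Cartesian_Product.vec_eq_iff, intro allI)
    fix i
    have wi: "(w $h i) * (1 - x) = (1 - x*k) * a $h i - s * z $h i"
      using d by (simp add: m divide_simps) (simp add: algebra_simps)
    have "((1 - y*k) * a $h i - s * w $h i) * (1 - x) = (1 - y) * z $h i * (1 - x)"
    proof -
      have "((1 - y*k) * a $h i - s * w $h i) * (1 - x)
          = (1 - x - k * (y * (1 - x))) * a $h i - s * (w $h i * (1 - x))"
        by (simp add: algebra_simps)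
      also have "\<dots> = (k * (1 + s) - 1) * x * a $h i + (1 - s - k * (1 - s\<^sup>2)) * a $h i + s\<^sup>2 * z $h i"
        unfolding y' wi by (simp add: algebra_simps power2_eq_square)
      also have "\<dots> = (1 - y) * (1 - x) * z $h i" unfolding y1 k k2 by simp
      finally show ?thesis by (simp add: mult_ac)
    qed
    then have e: "(1 - y*k) * a $h i - s * w $h i = (1 - y) * z $h i" using d by simp
    have "(inverse (1 - y) *s ((1 - y * k) *s a - s *s w)) $h i
        = inverse (1 - y) * ((1 - y*k) * a $h i - s * w $h i)"
      by (simp add: algebra_simps)
    then show "(inverse (1 - y) *s ((1 - y * k) *s a - s *s w)) $h i = z $h i"
      unfolding e using y0 by simp
  qed
  finally show ?thesis by (simp add: w_def)
qed

end

lemma ball_moebius_0 [simp]: "ball_moebius a 0 = a"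
  by (simp add: ball_moebius_def Let_def)

lemma ball_moebius_self: "a \<in> ball 0 1 \<Longrightarrow> ball_moebius a a = 0"
  using ball_moebius_ball_moebius[of a 0] by simp


subsection \<open>Holomorphic maps and the Schwarz lemma\<close>

lemma complex_linear_matrix:
  fixes f :: "complex^'n \<Rightarrow> complex^'m"
  assumes "\<And>x y. f (x + y) = f x + f y" "\<And>c x. f (c *s x) = c *s f x"
  shows "\<exists>A. \<forall>x. f x = A *v x"
proof -
  have "Vector_Spaces.linear (*s) (*s) f"
    by unfold_locales (simp_all add: assms vector_add_ldistrib vector_sadd_rdistrib)
  then show ?thesis by (metis matrix_works)
qed

lemma holo_on_iff_matrix:
  "holo_on f D \<longleftrightarrow> (\<forall>z\<in>D. \<exists>A. (f has_derivative (*v) A) (at z))"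
proof
  assume f: "holo_on f D"
  show "\<forall>z\<in>D. \<exists>A. (f has_derivative (*v) A) (at z)"
  proof
    fix z assume "z \<in> D"
    then obtain f' where f': "(f has_derivative f') (at z)" "\<And>c v. f' (c *s v) = c *s f' v"
      using f unfolding holo_on_def by blast
    obtain A where "\<forall>x. f' x = A *v x"
      using complex_linear_matrix[of f'] f'(2) has_derivative_linear[OF f'(1)] by (auto simp: linear_add)
    then have "f' = (*v) A" by auto
    with f'(1) show "\<exists>A. (f has_derivative (*v) A) (at z)" by auto
  qed
next
  assume "\<forall>z\<in>D. \<exists>A. (f has_derivative (*v) A) (at z)"
  then show "holo_on f D"
    unfolding holo_on_def using vector_scalar_commute by blast
qed

lemma has_derivative_matrix_compose:
  assumes "(f has_derivative (*v) A) (at z)" "(g has_derivative (*v) B) (at (f z))"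
  shows "((\<lambda>z. g (f z)) has_derivative (*v) (B ** A)) (at z)"
proof -
  have "(*v) B \<circ> (*v) A = (*v) (B ** A)" by (auto simp: matrix_vector_mul_assoc)
  then show ?thesis using diff_chain_at[OF assms] by (simp add: o_def)
qed

lemma holo_on_compose:
  assumes "holo_on f D" "holo_on g E" "f ` D \<subseteq> E"
  shows "holo_on (\<lambda>z. g (f z)) D"
  unfolding holo_on_iff_matrix
proof
  fix z assume z: "z \<in> D"
  obtain A where A: "(f has_derivative (*v) A) (at z)"
    using assms(1) z unfolding holo_on_iff_matrix by blast
  have "f z \<in> E" using assms(3) z by blast
  then obtain B where "(g has_derivative (*v) B) (at (f z))"
    using assms(2) unfolding holo_on_iff_matrix by blast
  from has_derivative_matrix_compose[OF A this]
  show "\<exists>A. ((\<lambda>z. g (f z)) has_derivative (*v) A) (at z)" by blast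
qed

lemma holo_on_cong:
  assumes "holo_on f D" "open D" "\<And>z. z \<in> D \<Longrightarrow> f z = g z"
  shows "holo_on g D"
  using assms unfolding holo_on_iff_matrix
  by (metis has_derivative_transform_within_open)

lemma holo_on_imp_continuous_on: "holo_on f D \<Longrightarrow> continuous_on D f"
  unfolding holo_on_iff_matrix
  by (meson continuous_at_imp_continuous_on has_derivative_continuous)

lemma bounded_bilinear_smult_vec: "bounded_bilinear ((*s) :: complex \<Rightarrow> complex^'n \<Rightarrow> _)"
  by (intro bounded_bilinear.intro exI[of _ 1])
     (simp_all add: vector_add_ldistrib vector_sadd_rdistrib, simp_all add: Finite_Cartesian_Product.vec_eq_iff)

text \<open>The bridge to one complex variable: restrict to a complex line and pair the value with a
  fixed vector.\<close>

lemma has_field_derivative_slice: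
  assumes "(f has_derivative (*v) A) (at (p + \<zeta> *s v))"
  shows "((\<lambda>\<zeta>. herm (f (p + \<zeta> *s v)) w) has_field_derivative herm (A *v v) w) (at \<zeta>)"
proof -
  have "((\<lambda>\<zeta>. p + \<zeta> *s v) has_derivative (\<lambda>h. h *s v)) (at \<zeta>)"
    by (auto intro!: derivative_eq_intros
        bounded_linear_imp_has_derivative[OF bounded_bilinear.bounded_linear_left[OF bounded_bilinear_smult_vec]])
  from diff_chain_at[OF this assms]
  have "((\<lambda>\<zeta>. f (p + \<zeta> *s v)) has_derivative (\<lambda>h. A *v (h *s v))) (at \<zeta>)"
    by (simp add: o_def)
  from bounded_linear.has_derivative[OF bounded_linear_herm this]
  show ?thesis
    by (simp add: has_field_derivative_def vector_scalar_commute mult_commute_abs)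
qed

text \<open>For unit \<open>v\<close> and \<open>w\<close> the slice maps the unit disc into itself
  and fixes 0, which are the hypotheses of the classical Schwarz lemma.\<close>

lemma schwarz_slice:
  fixes f :: "complex^'n \<Rightarrow> complex^'n"
  assumes f: "f \<in> Hol (ball 0 1)" "f 0 = 0" and v: "norm v = 1" and w: "norm w = 1"
  shows "(\<lambda>\<zeta>. herm (f (\<zeta> *s v)) w) holomorphic_on ball 0 1"
    and "norm \<zeta> < 1 \<Longrightarrow> cmod (herm (f (\<zeta> *s v)) w) < 1"
proof -
  have f': "holo_on f (ball 0 1)" "\<And>z. norm z < 1 \<Longrightarrow> norm (f z) < 1"
    using f by (auto simp: Hol_def image_subset_iff)
  have "\<exists>d. ((\<lambda>\<zeta>. herm (f (\<zeta> *s v)) w) has_field_derivative d) (at \<zeta>)" if "norm \<zeta> < 1" for \<zeta>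
  proof -
    have "\<zeta> *s v \<in> ball 0 1" using that v by simp
    with f'(1) have "\<exists>A. (f has_derivative (*v) A) (at (\<zeta> *s v))"
      unfolding holo_on_iff_matrix by blast
    then obtain A where "(f has_derivative (*v) A) (at (0 + \<zeta> *s v))" by auto
    from has_field_derivative_slice[OF this, of w] show ?thesis by auto
  qed
  then show "(\<lambda>\<zeta>. herm (f (\<zeta> *s v)) w) holomorphic_on ball 0 1"
    by (auto simp: holomorphic_on_open)
  show "cmod (herm (f (\<zeta> *s v)) w) < 1" if "norm \<zeta> < 1"
    using norm_herm_le[of "f (\<zeta> *s v)" w] f'(2)[of "\<zeta> *s v"] that v w by simp
qed

text \<open>Pairing with a unit vector along a value turns the norm of that value into the value of
  a slice. At the zero vector any unit vector serves.\<close>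

lemma norm_vec_direction:
  obtains v where "norm v = 1" "(x :: complex^'n) = of_real (norm x) *s v"
proof (cases "x = 0")
  case True
  then show ?thesis using that[of "axis undefined 1"] by simp
next
  case False
  then show ?thesis
    by (intro that[of "of_real (1 / norm x) *s x"]) (simp_all add: norm_divide)
qed

lemma herm_direction: "v = of_real r *s w \<Longrightarrow> norm w = 1 \<Longrightarrow> herm v w = of_real r"
  by (simp add: herm_self)

context
  fixes f :: "complex^'n \<Rightarrow> complex^'n"
  assumes f: "f \<in> Hol (ball 0 1)" "f 0 = 0"
begin

lemma schwarz_ball:
  assumes "z \<in> ball 0 1"
  shows "norm (f z) \<le> norm z"
proof -
  obtain v where v: "norm v = 1" "z = of_real (norm z) *s v" by (rule norm_vec_direction)
  obtain w where w: "norm w = 1" "f z = of_real (norm (f z)) *s w" by (rule norm_vec_direction)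
  have "cmod (herm (f (of_real (norm z) *s v)) w) \<le> norm (of_real (norm z) :: complex)"
    by (rule Schwarz_Lemma(1)) (use schwarz_slice[OF f v(1) w(1)] assms f(2) in auto)
  then show ?thesis using herm_direction[OF w(2,1)] v(2) by simp
qed

lemma schwarz_ball_derivative:
  assumes "(f has_derivative (*v) A) (at 0)"
  shows "norm (A *v z) \<le> norm z"
proof -
  obtain v where v: "norm v = 1" "z = of_real (norm z) *s v" by (rule norm_vec_direction)
  obtain w where w: "norm w = 1" "A *v v = of_real (norm (A *v v)) *s w" by (rule norm_vec_direction)
  have "norm (deriv (\<lambda>\<zeta>. herm (f (\<zeta> *s v)) w) 0) \<le> 1"
    by (rule Schwarz_Lemma(2)[where \<xi> = 0]) (use schwarz_slice[OF f v(1) w(1)] f(2) in auto)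
  moreover have "deriv (\<lambda>\<zeta>. herm (f (\<zeta> *s v)) w) 0 = herm (A *v v) w"
    using has_field_derivative_slice[of f A 0 0 v w] assms by (intro DERIV_imp_deriv) simp
  ultimately have "norm (A *v v) \<le> 1" using herm_direction[OF w(2,1)] by simp
  moreover have "A *v z = of_real (norm z) *s (A *v v)"
    using v(2) by (metis vector_scalar_commute)
  ultimately show ?thesis by (simp add: mult_left_le)
qed

text \<open>If \<open>f\<close> preserves norms, every slice attains equality in the one-variable Schwarz lemma, so it
  is a rotation into a fixed complex line.\<close>
lemma norm_preserving_imp_linear:
  assumes eq: "\<And>z. z \<in> ball 0 1 \<Longrightarrow> norm (f z) = norm z"
  shows "\<exists>U. \<forall>z\<in>ball 0 1. f z = U *v z"
proof -
  have "holo_on f (ball 0 1)" using f(1) by (simp add: Hol_def)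
  then have "\<exists>U. (f has_derivative (*v) U) (at 0)" unfolding holo_on_iff_matrix by simp
  then obtain U where U: "(f has_derivative (*v) U) (at 0)" by blast
  have "f z = U *v z" if z: "z \<in> ball 0 1" for z
  proof (cases "z = 0")
    case False
    obtain v where v: "norm v = 1" "z = of_real (norm z) *s v" by (rule norm_vec_direction)
    obtain w where w: "norm w = 1" "f z = of_real (norm (f z)) *s w" by (rule norm_vec_direction)
    let ?h = "\<lambda>\<zeta>. herm (f (\<zeta> *s v)) w"
    have "cmod (?h (of_real (norm z))) = norm (of_real (norm z) :: complex)"
      using herm_direction[OF w(2,1)] v(2) eq[OF z] by simp
    moreover have "norm (of_real (norm z) :: complex) < 1" "of_real (norm z) \<noteq> (0::complex)"
      using z False by auto
    ultimately have "\<exists>c. norm (of_real c :: complex) < 1" "\<exists>\<zeta>. norm \<zeta> < 1 \<and> \<zeta> \<noteq> 0 \<and> norm (?h \<zeta>) = norm \<zeta>"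
      by blast+
    then obtain \<alpha> where \<alpha>: "\<And>\<zeta>. norm \<zeta> < 1 \<Longrightarrow> ?h \<zeta> = \<alpha> * \<zeta>" "norm \<alpha> = 1"
      using Schwarz_Lemma(3)[of ?h 0] schwarz_slice[OF f v(1) w(1)] f(2) by auto
    have line: "f (\<zeta> *s v) = (\<alpha> * \<zeta>) *s w" if "norm \<zeta> < 1" for \<zeta>
    proof -
      have "norm (f (\<zeta> *s v)) = norm \<zeta>" using eq[of "\<zeta> *s v"] v(1) that by simp
      then have "cmod (herm (f (\<zeta> *s v)) w) = norm (f (\<zeta> *s v))"
        using \<alpha> that by (simp add: norm_mult)
      from herm_eq_norm_imp[OF w(1) this] show ?thesis using \<alpha>(1)[OF that] by simp
    qed
    \<comment> \<open>The derivative rule sees only scalar slices, so \<open>U *v v\<close> and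
      \<open>\<alpha> *s w\<close> are compared through their pairings with every \<open>x\<close>;
      taking \<open>x\<close> to be their difference makes them equal.\<close>
    have hx: "herm (U *v v) x = herm (\<alpha> *s w) x" for x
    proof (rule DERIV_unique)
      show "((\<lambda>\<zeta>. herm (f (0 + \<zeta> *s v)) x) has_field_derivative herm (U *v v) x) (at 0)"
        using U by (intro has_field_derivative_slice) simp
      have "((\<lambda>\<zeta>. \<zeta> * herm (\<alpha> *s w) x) has_field_derivative herm (\<alpha> *s w) x) (at 0)"
        by (auto intro!: derivative_eq_intros)
      then show "((\<lambda>\<zeta>. herm (f (0 + \<zeta> *s v)) x) has_field_derivative herm (\<alpha> *s w) x) (at 0)"
        by (rule has_field_derivative_transform_within_open[where S = "ball 0 1"]) (auto simp: line)
    qed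
    have "herm (U *v v - \<alpha> *s w) (U *v v - \<alpha> *s w) = 0"
      by (simp only: herm_linear(2) hx diff_self)
    then have "U *v v = \<alpha> *s w" by (simp add: herm_self)
    then have "U *v z = (of_real (norm z) * \<alpha>) *s w"
      using v(2) by (metis vector_scalar_commute vector_smult_assoc)
    moreover have "f z = (\<alpha> * of_real (norm z)) *s w" using line[of "of_real (norm z)"] v(2) z by simp
    ultimately show ?thesis by (simp add: mult.commute)
  qed (simp add: f)
  then show ?thesis by blast
qed

end

lemma HolI: "holo_on f D \<Longrightarrow> (\<And>z. z \<in> D \<Longrightarrow> f z \<in> D) \<Longrightarrow> f \<in> Hol D"
  by (auto simp: Hol_def)

lemma HolD:
  assumes "f \<in> Hol D"
  shows "holo_on f D" "\<And>z. z \<in> D \<Longrightarrow> f z \<in> D"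
  using assms by (auto simp: Hol_def)

lemma Hol_compose: "f \<in> Hol D \<Longrightarrow> g \<in> Hol D \<Longrightarrow> (\<lambda>z. g (f z)) \<in> Hol D"
  using holo_on_compose[of f D g D] by (auto simp: Hol_def)


subsection \<open>Linear fractional maps and automorphisms\<close>

definition lin_frac :: "(complex^'n \<Rightarrow> complex^'n) \<Rightarrow> bool" where
  "lin_frac f \<longleftrightarrow> (\<exists>(A :: complex^'n^'n) B C D. \<forall>z\<in>ball 0 1.
     herm z C + D \<noteq> 0 \<and> f z = inverse (herm z C + D) *s (A *v z + B))"

lemma LFM_iff: "f \<in> LFM \<longleftrightarrow> f \<in> Hol (ball 0 1) \<and> lin_frac f"
  by (simp add: LFM_def lin_frac_def)

lemma lin_frac_holo:
  fixes f :: "complex^'n \<Rightarrow> complex^'n"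
  assumes "lin_frac f"
  shows "holo_on f (ball 0 1)"
proof -
  obtain A B C D where f: "\<And>z. z \<in> ball 0 1 \<Longrightarrow> herm z C + D \<noteq> 0"
    "\<And>z. z \<in> ball 0 1 \<Longrightarrow> f z = inverse (herm z C + D) *s (A *v z + B)"
    using assms unfolding lin_frac_def by blast
  have "holo_on (\<lambda>z. inverse (herm z C + D) *s (A *v z + B)) (ball 0 1)"
    unfolding holo_on_def
  proof
    fix z :: "complex^'n" assume z: "z \<in> ball 0 1"
    let ?d = "inverse (herm z C + D)"
    have "((\<lambda>z. herm z C + D) has_derivative (\<lambda>v. herm v C)) (at z)"
      by (auto intro!: derivative_eq_intros bounded_linear_imp_has_derivative[OF bounded_linear_herm])
    then have "((\<lambda>z. inverse (herm z C + D)) has_derivative (\<lambda>v. - (?d * herm v C * ?d))) (at z)"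
      by (rule Deriv.has_derivative_inverse[rotated]) (rule f(1)[OF z])
    moreover have "((\<lambda>z. A *v z + B) has_derivative (*v) A) (at z)"
      by (auto intro!: derivative_eq_intros
          bounded_linear_imp_has_derivative[OF matrix_vector_mul_bounded_linear])
    ultimately have "((\<lambda>z. inverse (herm z C + D) *s (A *v z + B)) has_derivative
        (\<lambda>v. ?d *s (A *v v) + (- (?d * herm v C * ?d)) *s (A *v z + B))) (at z)"
      by (rule bounded_bilinear.FDERIV[OF bounded_bilinear_smult_vec])
    moreover have "?d *s (A *v (c *s v)) + (- (?d * herm (c *s v) C * ?d)) *s (A *v z + B)
        = c *s (?d *s (A *v v) + (- (?d * herm v C * ?d)) *s (A *v z + B))" for c v
      by (simp add: vector_scalar_commute Finite_Cartesian_Product.vec_eq_iff algebra_simps)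
    ultimately show "\<exists>f'. ((\<lambda>z. inverse (herm z C + D) *s (A *v z + B)) has_derivative f') (at z) \<and>
        (\<forall>c v. f' (c *s v) = c *s f' v)" by blast
  qed
  then show ?thesis by (rule holo_on_cong) (simp_all add: f(2))
qed

lemma herm_adjoint:
  "herm (A *v z) w = herm z ((\<chi> i j. cnj (A $h j $h i)) *v w)"
proof -
  have "herm (A *v z) w = (\<Sum>i\<in>UNIV. \<Sum>j\<in>UNIV. A $h i $h j * z $h j * cnj (w $h i))"
    by (simp add: herm_def matrix_vector_mult_def sum_distrib_right)
  also have "\<dots> = (\<Sum>j\<in>UNIV. \<Sum>i\<in>UNIV. A $h i $h j * z $h j * cnj (w $h i))"
    by (rule sum.swap)
  also have "\<dots> = herm z ((\<chi> i j. cnj (A $h j $h i)) *v w)"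
    by (simp add: herm_def matrix_vector_mult_def sum_distrib_left mult_ac)
  finally show ?thesis .
qed

text \<open>Multiplying the numerator and denominator of \<open>g (f z)\<close> by the denominator
  of \<open>f\<close> leaves both affine. The adjoint carries \<open>A\<close> over to
  \<open>C'\<close>, and conjugate linearity of the second slot puts the conjugate on
  \<open>D'\<close>.\<close>

lemma lin_frac_compose:
  fixes f g :: "complex^'n \<Rightarrow> complex^'n"
  assumes f: "lin_frac f" "\<And>z. z \<in> ball 0 1 \<Longrightarrow> f z \<in> ball 0 1" and g: "lin_frac g"
  shows "lin_frac (\<lambda>z. g (f z))"
proof -
  obtain A B C D where f': "\<And>z. z \<in> ball 0 1 \<Longrightarrow> herm z C + D \<noteq> 0"
    "\<And>z. z \<in> ball 0 1 \<Longrightarrow> f z = inverse (herm z C + D) *s (A *v z + B)"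
    using f(1) unfolding lin_frac_def by blast
  obtain A' B' C' D' where g': "\<And>z. z \<in> ball 0 1 \<Longrightarrow> herm z C' + D' \<noteq> 0"
    "\<And>z. z \<in> ball 0 1 \<Longrightarrow> g z = inverse (herm z C' + D') *s (A' *v z + B')"
    using g unfolding lin_frac_def by blast
  obtain A2 where A2: "\<And>z. A' *v (A *v z) + herm z C *s B' = A2 *v z"
    using complex_linear_matrix[of "\<lambda>z. A' *v (A *v z) + herm z C *s B'"]
    by (auto simp: matrix_vector_right_distrib vector_scalar_commute vector_add_ldistrib
        vector_sadd_rdistrib algebra_simps)
  define B2 where "B2 = A' *v B + D *s B'"
  define C2 where "C2 = (\<chi> i j. cnj (A $h j $h i)) *v C' + cnj D' *s C"
  define D2 where "D2 = herm B C' + D * D'"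
  have "herm z C2 + D2 \<noteq> 0 \<and> g (f z) = inverse (herm z C2 + D2) *s (A2 *v z + B2)"
    if z: "z \<in> ball 0 1" for z
  proof -
    let ?d = "herm z C + D" and ?e = "herm (f z) C' + D'"
    have d: "?d \<noteq> 0" using f'(1)[OF z] .
    have e: "?e \<noteq> 0" using g'(1)[OF f(2)[OF z]] .
    have "?d * herm (f z) C' = herm (A *v z + B) C'"
      unfolding f'(2)[OF z] herm_linear(3)
      using d by (simp add: mult.assoc[symmetric] del: herm_linear(1))
    then have "?d * ?e = herm (A *v z + B) C' + ?d * D'" by (simp only: distrib_left)
    then have de: "herm z C2 + D2 = ?d * ?e"
      by (simp add: C2_def D2_def herm_adjoint[symmetric] algebra_simps)
    have "A2 *v z + B2 = ?d *s (A' *v f z + B')"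
      using d by (simp add: f'(2)[OF z] A2[symmetric] B2_def vector_scalar_commute matrix_vector_right_distrib
          vector_add_ldistrib vector_sadd_rdistrib)
    moreover have "inverse (a * b) *s (a *s x) = inverse b *s x" if "a \<noteq> 0" for a b and x :: "complex^'n"
      using that by (simp add: Finite_Cartesian_Product.vec_eq_iff)
    note this[OF d]
    ultimately have "inverse (herm z C2 + D2) *s (A2 *v z + B2) = inverse ?e *s (A' *v f z + B')"
      by (simp only: de)
    with de d e show ?thesis using g'(2)[OF f(2)[OF z]] by simp
  qed
  then show ?thesis unfolding lin_frac_def by blast
qed

lemma lin_frac_linear: "(\<And>z. z \<in> ball 0 1 \<Longrightarrow> f z = A *v z) \<Longrightarrow> lin_frac f"
  unfolding lin_frac_def by (intro exI[of _ A] exI[of _ 0] exI[of _ 1]) simp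

lemma lin_frac_ball_moebius:
  assumes a: "a \<in> ball 0 1"
  shows "lin_frac (ball_moebius a)"
proof -
  define s :: complex where "s = of_real (sqrt (1 - (norm a)\<^sup>2))"
  define k where "k = inverse (1 + s)"
  have "\<exists>A. \<forall>z. - (herm z a * k) *s a - s *s z = A *v z"
    by (rule complex_linear_matrix) (simp_all add: Finite_Cartesian_Product.vec_eq_iff algebra_simps)
  then obtain A where A: "\<And>z. - (herm z a * k) *s a - s *s z = A *v z" by blast
  have "herm z (- a) + 1 \<noteq> 0 \<and> ball_moebius a z = inverse (herm z (- a) + 1) *s (A *v z + a)"
    if "z \<in> ball 0 1" for z
    using one_minus_herm_ne[OF that a]
    by (simp add: ball_moebius_def Let_def s_def[symmetric] A[symmetric] divide_inverse k_def[symmetric]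
        Finite_Cartesian_Product.vec_eq_iff algebra_simps)
  then show ?thesis unfolding lin_frac_def by blast
qed

lemma ball_moebius_Hol: "a \<in> ball 0 1 \<Longrightarrow> ball_moebius a \<in> Hol (ball 0 1)"
  using lin_frac_holo[OF lin_frac_ball_moebius] ball_moebius_in_ball by (blast intro: HolI)

text \<open>Moving \<open>x\<close> and \<open>f x\<close> to 0 by their involutions reduces this to
  the Schwarz lemma; passing from the norm to one minus its square reverses the inequality.\<close>

lemma schwarz_pick:
  assumes f: "f \<in> Hol (ball 0 1)" and x: "x \<in> ball 0 1" and y: "y \<in> ball 0 1"
  shows "kappa x y \<le> kappa (f x) (f y)"
proof -
  note fx = HolD(2)[OF f x] and fy = HolD(2)[OF f y]
  let ?F = "\<lambda>z. ball_moebius (f x) (f (ball_moebius x z))"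
  have F: "?F \<in> Hol (ball 0 1)"
    by (intro Hol_compose[OF ball_moebius_Hol[OF x]] Hol_compose[OF f] ball_moebius_Hol fx)
  have "norm (?F (ball_moebius x y)) \<le> norm (ball_moebius x y)"
    using fx by (intro schwarz_ball[OF F] ball_moebius_in_ball x y) (simp add: ball_moebius_self)
  then have "(norm (ball_moebius (f x) (f y)))\<^sup>2 \<le> (norm (ball_moebius x y))\<^sup>2"
    using ball_moebius_ball_moebius[OF x y] by (simp add: power_mono)
  then show ?thesis using one_minus_norm_ball_moebius[OF x y] one_minus_norm_ball_moebius[OF fx fy] by linarith
qed

lemma biholomorphic_inverse:
  assumes "biholomorphic \<sigma> D D"
  shows "\<sigma> \<in> Hol D" "inv_into D \<sigma> \<in> Hol D"
    "\<And>z. z \<in> D \<Longrightarrow> inv_into D \<sigma> (\<sigma> z) = z" "\<And>z. z \<in> D \<Longrightarrow> \<sigma> (inv_into D \<sigma> z) = z"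
proof -
  have b: "bij_betw \<sigma> D D" using assms by (simp add: biholomorphic_def)
  then show i: "\<And>z. z \<in> D \<Longrightarrow> inv_into D \<sigma> (\<sigma> z) = z" "\<And>z. z \<in> D \<Longrightarrow> \<sigma> (inv_into D \<sigma> z) = z"
    by (auto simp: bij_betw_inv_into_left bij_betw_inv_into_right)
  show "\<sigma> \<in> Hol D" "inv_into D \<sigma> \<in> Hol D"
    using assms b bij_betw_inv_into[OF b] unfolding biholomorphic_def Hol_def bij_betw_def by auto
qed

text \<open>The Schwarz lemma bounds both \<open>g\<close> and its inverse \<open>h\<close>, so
  \<open>g\<close> preserves norms and is linear on the ball. Applying the involution at
  \<open>b\<close> once more recovers \<open>s\<close>.\<close>

lemma automorphism_lin_frac:
  assumes s: "s \<in> Hol (ball 0 1)" and r: "r \<in> Hol (ball 0 1)"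
    and rs: "\<And>z. z \<in> ball 0 1 \<Longrightarrow> r (s z) = z" and sr: "\<And>z. z \<in> ball 0 1 \<Longrightarrow> s (r z) = z"
  shows "lin_frac s"
proof -
  define b where "b = s 0"
  have b: "b \<in> ball 0 1" using HolD(2)[OF s, of 0] by (simp add: b_def)
  define g where "g z = ball_moebius b (s z)" for z
  define h where "h z = r (ball_moebius b z)" for z
  have g: "g \<in> Hol (ball 0 1)" unfolding g_def by (intro Hol_compose[OF s] ball_moebius_Hol b)
  have h: "h \<in> Hol (ball 0 1)" unfolding h_def by (intro Hol_compose[OF ball_moebius_Hol[OF b]] r)
  have g0: "g 0 = 0" using b by (simp add: g_def b_def ball_moebius_self)
  have h0: "h 0 = 0" using rs[of 0] by (simp add: h_def b_def)
  have hg: "h (g z) = z" if "z \<in> ball 0 1" for z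
    using that ball_moebius_ball_moebius[OF b HolD(2)[OF s that]] rs by (simp add: g_def h_def)
  have gn: "norm (g z) = norm z" if "z \<in> ball 0 1" for z
    using schwarz_ball[OF g g0 that] schwarz_ball[OF h h0 HolD(2)[OF g that]] hg[OF that] by simp
  have "\<exists>U. \<forall>z\<in>ball 0 1. g z = U *v z"
    using norm_preserving_imp_linear[OF g g0] gn by simp
  then obtain U where U: "\<forall>z\<in>ball 0 1. g z = U *v z" ..
  have "lin_frac (\<lambda>z. ball_moebius b (g z))"
    by (rule lin_frac_compose[OF lin_frac_linear[OF bspec[OF U]] HolD(2)[OF g] lin_frac_ball_moebius[OF b]])
  moreover have "ball_moebius b (g z) = s z" if "z \<in> ball 0 1" for z
    unfolding g_def by (rule ball_moebius_ball_moebius[OF b HolD(2)[OF s that]])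
  ultimately show ?thesis by (simp add: lin_frac_def)
qed


subsection \<open>The common fixed point of a semigroup\<close>

lemma kappa_le_1: "a \<in> ball 0 1 \<Longrightarrow> z \<in> ball 0 1 \<Longrightarrow> kappa a z \<le> 1"
  using one_minus_norm_ball_moebius[of a z] by (simp flip: one_minus_norm_ball_moebius)

lemma kappa_less_1:
  assumes "a \<in> ball 0 1" "z \<in> ball 0 1" "a \<noteq> z"
  shows "kappa a z < 1"
proof -
  have "ball_moebius a z \<noteq> 0" using ball_moebius_ball_moebius[OF assms(1,2)] assms(3) by auto
  then have "0 < (norm (ball_moebius a z))\<^sup>2" by simp
  then show ?thesis using one_minus_norm_ball_moebius[OF assms(1,2)] by linarith
qed

text \<open>As \<open>kappa = 1 / cosh\<^sup>2 d\<close> for the hyperbolic distance \<open>d\<close>, this is the strict convexity of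
  balls: the midpoint of two points is strictly closer to every point than the farther of the two.
  It is computed as the sum of normalised lifts of the two points to the hyperboloid.\<close>
lemma kappa_midpoint:
  assumes c: "c \<in> ball 0 1" and c': "c' \<in> ball 0 1" and ne: "c \<noteq> c'"
  obtains m q where "m \<in> ball 0 1" "q > 1"
    "\<And>x R. x \<in> ball 0 1 \<Longrightarrow> R > 0 \<Longrightarrow> kappa c x \<ge> R \<Longrightarrow> kappa c' x \<ge> R \<Longrightarrow> kappa m x \<ge> q * R"
proof -
  define g where "g = sqrt (1 - (norm c)\<^sup>2)"
  define g' where "g' = sqrt (1 - (norm c')\<^sup>2)"
  have n: "(norm c)\<^sup>2 < 1" "(norm c')\<^sup>2 < 1" using c c' by (simp_all add: power_less_one_iff abs_square_less_1)
  have g: "g > 0" "g\<^sup>2 = 1 - (norm c)\<^sup>2" "g' > 0" "g'\<^sup>2 = 1 - (norm c')\<^sup>2"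
    using n by (simp_all add: g_def g'_def)
  define e where "e = 1 - herm c c'"
  have e: "e \<noteq> 0" using one_minus_herm_ne[OF c c'] by (simp add: e_def)
  have e': "1 - herm c' c = cnj e" by (simp add: e_def cnj_herm)
  \<comment> \<open>The form \<open>p * cnj p - herm v v\<close> is Lorentzian on pairs
    \<open>(p, v)\<close>. The scalars \<open>\<alpha>\<close> and \<open>\<beta>\<close> normalise
    the lifts \<open>(1, c)\<close> and \<open>(1, c')\<close> to square 1, and the phase of
    \<open>\<beta>\<close> makes their mutual product the positive number
    \<open>cmod e / (g * g')\<close>.\<close>
  define \<alpha> :: complex where "\<alpha> = of_real (1 / g)"
  define \<beta> where "\<beta> = e / of_real (cmod e * g')"
  have a: "cnj \<alpha> = \<alpha>" "cmod \<alpha> = 1 / g" "\<alpha> * \<alpha> * (1 - herm c c) = 1"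
  proof -
    show "cnj \<alpha> = \<alpha>" "cmod \<alpha> = 1 / g" using g by (simp_all add: \<alpha>_def norm_divide)
    have "1 - herm c c = of_real (g\<^sup>2)" by (simp add: herm_self g(2))
    then have "\<alpha> * \<alpha> * (1 - herm c c) = of_real (1 / g * (1 / g) * g\<^sup>2)"
      unfolding \<alpha>_def by (simp only: of_real_mult)
    also have "1 / g * (1 / g) * g\<^sup>2 = 1" using g(1) by (simp add: power2_eq_square)
    finally show "\<alpha> * \<alpha> * (1 - herm c c) = 1" by simp
  qed
  have ee: "e * cnj e = of_real (cmod e) * of_real (cmod e)"
    unfolding complex_norm_square[symmetric] by (simp add: power2_eq_square)
  have b: "cmod \<beta> = 1 / g'" "\<beta> * cnj \<beta> * (1 - herm c' c') = 1"
      "e * cnj \<beta> = of_real (cmod e / g')" "cnj e * \<beta> = of_real (cmod e / g')"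
  proof -
    show "cmod \<beta> = 1 / g'" using g e by (simp add: \<beta>_def norm_divide norm_mult)
    then have "\<beta> * cnj \<beta> = of_real ((1 / g')\<^sup>2)" by (metis complex_norm_square)
    moreover have "1 - herm c' c' = of_real (g'\<^sup>2)" by (simp add: herm_self g(4))
    ultimately have "\<beta> * cnj \<beta> * (1 - herm c' c') = of_real ((1 / g')\<^sup>2 * g'\<^sup>2)" by (simp only: of_real_mult)
    also have "(1 / g')\<^sup>2 * g'\<^sup>2 = 1" using g(3) by (simp add: power_divide)
    finally show "\<beta> * cnj \<beta> * (1 - herm c' c') = 1" by simp
    show "e * cnj \<beta> = of_real (cmod e / g')" "cnj e * \<beta> = of_real (cmod e / g')"
      using e g(3) ee by (simp_all add: \<beta>_def field_simps)
  qed
  define p where "p = \<alpha> + \<beta>"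
  define v where "v = \<alpha> *s c + \<beta> *s c'"
  \<comment> \<open>The Lorentzian square of the sum of the two lifts: two unit squares and twice
    the mutual product.\<close>
  define N where "N = 2 + 2 * cmod e / (g * g')"
  have "p * cnj p - herm v v = \<alpha> * \<alpha> * (1 - herm c c) + \<beta> * cnj \<beta> * (1 - herm c' c')
      + \<alpha> * ((1 - herm c c') * cnj \<beta>) + \<alpha> * ((1 - herm c' c) * \<beta>)"
    by (simp add: p_def v_def a(1) algebra_simps)
  also have "\<dots> = of_real N"
    unfolding a(3) b(2) e' unfolding e_def[symmetric] b(3,4) by (simp add: N_def \<alpha>_def)
  finally have "of_real ((cmod p)\<^sup>2 - (norm v)\<^sup>2) = (of_real N :: complex)"
    by (simp only: of_real_diff complex_norm_square flip: herm_self)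
  then have N: "(cmod p)\<^sup>2 - (norm v)\<^sup>2 = N" by (simp only: of_real_eq_iff)
  \<comment> \<open>Strictness enters here: for distinct points the mutual product of the unit lifts
    exceeds 1, whence \<open>N > 4\<close>.\<close>
  have "kappa c' c < 1" using kappa_less_1[OF c' c] ne by blast
  then have "(g * g')\<^sup>2 < (cmod e)\<^sup>2"
    using e by (simp add: kappa_def e_def[symmetric] power_mult_distrib g(2,4) mult.commute)
  then have "g * g' < cmod e" by (rule power_less_imp_less_base) simp
  then have N4: "N > 4" using g by (simp add: N_def field_simps)
  have p0: "p \<noteq> 0"
  proof
    assume "p = 0"
    then have "N \<le> 0" using N by (simp flip: N)
    with N4 show False by simp
  qed
  define m where "m = inverse p *s v"
  have nm: "1 - (norm m)\<^sup>2 = N / (cmod p)\<^sup>2"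
  proof -
    have "(norm m)\<^sup>2 = (norm v)\<^sup>2 / (cmod p)\<^sup>2"
      by (simp add: m_def norm_inverse power_mult_distrib power_inverse divide_inverse mult.commute)
    then have "1 - (norm m)\<^sup>2 = ((cmod p)\<^sup>2 - (norm v)\<^sup>2) / (cmod p)\<^sup>2"
      using p0 by (simp add: diff_divide_distrib)
    then show ?thesis by (simp only: N)
  qed
  then have "1 - (norm m)\<^sup>2 > 0" using N4 p0 by simp
  then have m: "m \<in> ball 0 1" using abs_square_less_1[of "norm m"] by simp
  have "kappa m x \<ge> N / 4 * R"
    if x: "x \<in> ball 0 1" and R: "R > 0" "kappa c x \<ge> R" "kappa c' x \<ge> R" for x R
  proof -
    have nx: "1 - (norm x)\<^sup>2 > 0" using x by (simp add: power_less_one_iff abs_square_less_1)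
    define L where "L = cmod (cnj p - herm x v)"
    \<comment> \<open>In terms of \<open>S\<close> the bound \<open>kappa d x \<ge> R\<close> says
      that the product of \<open>(1, x)\<close> with the unit lift of \<open>d\<close> has modulus
      at most \<open>S\<close>. The triangle inequality gives \<open>L \<le> 2 * S\<close> for the
      summed lift, so the gain is \<open>N / 4\<close>.\<close>
    define S where "S = sqrt ((1 - (norm x)\<^sup>2) / R)"
    have S: "S > 0" "S\<^sup>2 = (1 - (norm x)\<^sup>2) / R" using nx R by (simp_all add: S_def)
    have part: "cmod (1 - herm x d) / h \<le> S"
      if "d \<in> ball 0 1" "h > 0" "h\<^sup>2 = 1 - (norm d)\<^sup>2" "kappa d x \<ge> R" for d and h :: real
    proof -
      have "(cmod (1 - herm x d))\<^sup>2 * R \<le> h\<^sup>2 * (1 - (norm x)\<^sup>2)"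
      proof -
        have "R \<le> h\<^sup>2 * (1 - (norm x)\<^sup>2) / (cmod (1 - herm x d))\<^sup>2"
          using that(4) by (simp only: kappa_def that(3))
        moreover have "0 < (cmod (1 - herm x d))\<^sup>2" using one_minus_herm_ne[OF x that(1)] by simp
        ultimately show ?thesis by (simp only: pos_le_divide_eq mult.commute)
      qed
      then have "(cmod (1 - herm x d) / h)\<^sup>2 \<le> S\<^sup>2"
        using that(2) R(1) by (simp add: S(2) power_divide field_simps)
      then show ?thesis using S(1) by (rule_tac power2_le_imp_le) auto
    qed
    have "cnj p - herm x v = \<alpha> * (1 - herm x c) + cnj \<beta> * (1 - herm x c')"
      by (simp add: p_def v_def a(1) algebra_simps)
    then have "L \<le> cmod (1 - herm x c) / g + cmod (1 - herm x c') / g'"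
      unfolding L_def by (metis (no_types, lifting) norm_triangle_ineq norm_mult a(2) b(1) complex_mod_cnj
          mult_1 times_divide_eq_left)
    also have "\<dots> \<le> 2 * S" using part[OF c g(1,2) R(2)] part[OF c' g(3,4) R(3)] by simp
    finally have "L\<^sup>2 \<le> (2 * S)\<^sup>2" by (rule power_mono) (simp add: L_def)
    then have L2: "L\<^sup>2 * R \<le> 4 * (1 - (norm x)\<^sup>2)" using R(1) by (simp add: power_mult_distrib S(2) field_simps)
    have "1 - herm x m = (cnj p - herm x v) / cnj p" using p0 by (simp add: m_def field_simps)
    then have "cmod (1 - herm x m) = L / cmod p" by (simp add: L_def norm_divide)
    moreover have "1 - herm x m \<noteq> 0" using one_minus_herm_ne[OF x m] .
    ultimately have L0: "L > 0" and km: "kappa m x = N * (1 - (norm x)\<^sup>2) / L\<^sup>2"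
      using p0 unfolding kappa_def nm by (auto simp: L_def power_divide)
    have "N * (L\<^sup>2 * R) \<le> N * (4 * (1 - (norm x)\<^sup>2))" using L2 N4 by (intro mult_left_mono) auto
    then show ?thesis using L0 by (simp add: km field_simps)
  qed
  with m N4 show ?thesis by (intro that[of m "N / 4"]) auto
qed

lemma semigroup_onD:
  assumes "semigroup_on D \<Phi>"
  shows "\<And>t. 0 \<le> t \<Longrightarrow> \<Phi> t \<in> Hol D" "\<And>z. z \<in> D \<Longrightarrow> \<Phi> 0 z = z"
    "\<And>t s z. 0 \<le> t \<Longrightarrow> 0 \<le> s \<Longrightarrow> z \<in> D \<Longrightarrow> \<Phi> (t + s) z = \<Phi> t (\<Phi> s z)"
  using assms by (auto simp: semigroup_on_def)

lemma semigroup_on_openin: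
  assumes "semigroup_on D \<Phi>" "compact K" "K \<subseteq> D" "open V"
  shows "openin (top_of_set {0..}) {t \<in> {0..}. \<Phi> t ` K \<subseteq> V}"
proof -
  have "continuous_map (top_of_set {0..}) (compact_open D) \<Phi>" using assms by (simp add: semigroup_on_def)
  moreover have "openin (compact_open D) {f \<in> Hol D. f ` K \<subseteq> V}"
    unfolding compact_open_def using assms(2-) by (intro topology_generated_by_Basis) blast
  ultimately have "openin (top_of_set {0..}) {t \<in> topspace (top_of_set {0..}). \<Phi> t \<in> {f \<in> Hol D. f ` K \<subseteq> V}}"
    by (rule openin_continuous_map_preimage)
  moreover have "{t \<in> topspace (top_of_set {0..}). \<Phi> t \<in> {f \<in> Hol D. f ` K \<subseteq> V}} = {t \<in> {0..}. \<Phi> t ` K \<subseteq> V}"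
    using semigroup_onD(1)[OF assms(1)] by auto
  ultimately show ?thesis by simp
qed

lemma semigroup_on_orbit_continuous:
  assumes "semigroup_on D \<Phi>" "z \<in> D"
  shows "continuous_on {0..} (\<lambda>t. \<Phi> t z)"
  unfolding continuous_openin_preimage_eq
proof safe
  fix T :: "(complex^'a) set" assume "open T"
  with semigroup_on_openin[OF assms(1), of "{z}" T] assms(2)
  have "openin (top_of_set {0..}) {t \<in> {0..}. \<Phi> t ` {z} \<subseteq> T}" by simp
  moreover have "{t \<in> {0..}. \<Phi> t ` {z} \<subseteq> T} = {0..} \<inter> (\<lambda>t. \<Phi> t z) -` T" by auto
  ultimately show "openin (top_of_set {0..}) ({0..} \<inter> (\<lambda>t. \<Phi> t z) -` T)" by simp
qed

text \<open>The orbit of a fixed point of \<open>\<Phi> 1\<close> is periodic, hence contained in a compact subset of the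
  ball; its circumcentre for the hyperbolic metric is unique and therefore fixed by the semigroup.\<close>
lemma semigroup_on_common_fixed_point:
  fixes \<Phi> :: "real \<Rightarrow> complex^'n \<Rightarrow> complex^'n"
  assumes \<Phi>: "semigroup_on (ball 0 1) \<Phi>" and a: "a \<in> ball 0 1" "\<Phi> 1 a = a"
  obtains q where "q \<in> ball 0 1" "\<And>t. 0 \<le> t \<Longrightarrow> \<Phi> t q = q"
proof -
  note H = semigroup_onD[OF \<Phi>]
  define x where "x t = \<Phi> t a" for t
  have x: "x t \<in> ball 0 1" if "0 \<le> t" for t
    unfolding x_def using HolD(2)[OF H(1)[OF that]] a(1) .
  have per: "x (t + real n) = x t" if "0 \<le> t" for t n
  proof (induction n)
    case (Suc n)
    have "x (t + real n + 1) = \<Phi> (t + real n) (\<Phi> 1 a)"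
      unfolding x_def using that a(1) by (intro H(3)) auto
    also have "\<dots> = x t" using Suc a(2) by (simp add: x_def)
    finally show ?case by (simp add: add_ac)
  qed simp
  \<comment> \<open>A number \<open>r\<close> that is good for \<open>c\<close> encodes a ball
    around \<open>c\<close> containing the orbit. As \<open>kappa\<close> decreases with distance,
    the least radius becomes the supremum \<open>R\<close>.\<close>
  define good where "good c r \<longleftrightarrow> c \<in> ball 0 1 \<and> (\<forall>t\<ge>0. kappa c (x t) \<ge> r)" for c r
  define R where "R = Sup {r. \<exists>c. good c r}"
  have bdd: "bdd_above {r. \<exists>c. good c r}"
  proof (rule bdd_aboveI[of _ 1])
    fix r assume "r \<in> {r. \<exists>c. good c r}"
    then obtain c where "c \<in> ball 0 1" "r \<le> kappa c (x 0)" by (auto simp: good_def)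
    then show "r \<le> 1" using kappa_le_1[of c "x 0"] x[of 0] by simp
  qed
  \<comment> \<open>One period carries the whole orbit, so a minimum over \<open>{0..1}\<close> is a
    bound for all times; its positivity gives \<open>R > 0\<close>.\<close>
  have "continuous_on {0..1} (\<lambda>t. kappa a (x t))"
    unfolding kappa_def using one_minus_herm_ne[OF x a(1)]
    by (intro continuous_intros continuous_on_compose2[OF continuous_on_herm_left[OF continuous_on_id]]
        continuous_on_subset[OF semigroup_on_orbit_continuous[OF \<Phi> a(1)], folded x_def]) auto
  then obtain t0 where t0: "t0 \<in> {0..1}" "\<And>t. t \<in> {0..1} \<Longrightarrow> kappa a (x t0) \<le> kappa a (x t)"
    using continuous_attains_inf[of "{0..1::real}" "\<lambda>t. kappa a (x t)"] by auto
  have "good a (kappa a (x t0))"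
    unfolding good_def
  proof (intro conjI allI impI a(1))
    fix t :: real assume t: "0 \<le> t"
    have "t = frac t + real (nat \<lfloor>t\<rfloor>)" using t by (simp add: frac_def)
    then have "x t = x (frac t)" using per[of "frac t" "nat \<lfloor>t\<rfloor>"] by simp
    moreover have "frac t \<in> {0..1}" using frac_lt_1[of t] by auto
    ultimately show "kappa a (x t0) \<le> kappa a (x t)" using t0(2) by simp
  qed
  moreover have "0 < kappa a (x t0)" using t0(1) by (intro kappa_pos a(1) x) auto
  ultimately have R0: "R > 0" using cSup_upper[OF _ bdd, of "kappa a (x t0)"] unfolding R_def by force
  have ne: "{r. \<exists>c. good c r} \<noteq> {}" using \<open>good a (kappa a (x t0))\<close> by auto
  have "\<exists>c. good c (R - inverse (real (Suc n)))" for n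
  proof -
    have "R - inverse (real (Suc n)) < Sup {r. \<exists>c. good c r}" by (simp add: R_def[symmetric])
    then obtain r c where "R - inverse (real (Suc n)) < r" "good c r"
      using less_cSupE[OF _ ne] by blast
    then have "good c (R - inverse (real (Suc n)))" by (force simp: good_def)
    then show ?thesis ..
  qed
  then obtain c where c: "\<And>n. good (c n) (R - inverse (real (Suc n)))" by metis
  have "\<forall>n. c n \<in> cball 0 1" using c by (auto simp: good_def less_imp_le)
  then obtain q r where q: "q \<in> cball 0 1" "strict_mono r" "(c \<circ> r) \<longlonglongrightarrow> q"
    using compact_cball[of "0 :: complex^'n" 1] unfolding compact_def by metis
  have lim: "(\<lambda>n. R - inverse (real (Suc (r n)))) \<longlonglongrightarrow> R"
  proof -
    have "(\<lambda>n. R - inverse (real (Suc n))) \<longlonglongrightarrow> R - 0"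
      by (intro tendsto_intros LIMSEQ_inverse_real_of_nat)
    from LIMSEQ_subseq_LIMSEQ[OF this q(2)] show ?thesis by (simp add: o_def)
  qed
  \<comment> \<open>The limit \<open>q\<close> of nearly optimal centres is so far known only to lie
    in the closed ball, so the bound is passed to the limit with the denominator of
    \<open>kappa\<close> multiplied out.\<close>
  have ineq: "R * (cmod (1 - herm (x t) q))\<^sup>2 \<le> (1 - (norm q)\<^sup>2) * (1 - (norm (x t))\<^sup>2)" if t: "0 \<le> t" for t
  proof (rule LIMSEQ_le)
    have q': "(\<lambda>n. c (r n)) \<longlonglongrightarrow> q" using q(3) by (simp add: o_def)
    show "(\<lambda>n. (1 - (norm (c (r n)))\<^sup>2) * (1 - (norm (x t))\<^sup>2)) \<longlonglongrightarrow> (1 - (norm q)\<^sup>2) * (1 - (norm (x t))\<^sup>2)"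
      by (intro tendsto_intros q')
    show "(\<lambda>n. (R - inverse (real (Suc (r n)))) * (cmod (1 - herm (x t) (c (r n))))\<^sup>2)
        \<longlonglongrightarrow> R * (cmod (1 - herm (x t) q))\<^sup>2"
      by (intro tendsto_intros q' lim bounded_linear.tendsto[OF bounded_linear_herm_right])
    have "(R - inverse (real (Suc n))) * (cmod (1 - herm (x t) (c n)))\<^sup>2
        \<le> (1 - (norm (c n))\<^sup>2) * (1 - (norm (x t))\<^sup>2)" for n
    proof -
      have "c n \<in> ball 0 1" and k: "R - inverse (real (Suc n)) \<le> kappa (c n) (x t)"
        using c[of n] t by (auto simp: good_def)
      then have "0 < (cmod (1 - herm (x t) (c n)))\<^sup>2" using one_minus_herm_ne[OF x[OF t]] by simp
      then show ?thesis using k by (simp only: kappa_def pos_le_divide_eq)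
    qed
    then show "\<exists>N. \<forall>n\<ge>N. (R - inverse (real (Suc (r n)))) * (cmod (1 - herm (x t) (c (r n))))\<^sup>2
        \<le> (1 - (norm (c (r n)))\<^sup>2) * (1 - (norm (x t))\<^sup>2)" by blast
  qed
  \<comment> \<open>On the boundary the right-hand side of \<open>ineq\<close> would vanish, while
    its left-hand side is positive because \<open>R > 0\<close>.\<close>
  have q1: "q \<in> ball 0 1"
  proof -
    have "cmod (herm (x 0) q) \<le> norm (x 0) * norm q" by (rule norm_herm_le)
    also have "\<dots> < 1" using x[of 0] q(1) mult_left_le[of "norm q" "norm (x 0)"] by simp
    finally have "1 - herm (x 0) q \<noteq> 0" by auto
    then have "0 < R * (cmod (1 - herm (x 0) q))\<^sup>2" using R0 by simp
    with ineq[of 0] have "0 < (1 - (norm q)\<^sup>2) * (1 - (norm (x 0))\<^sup>2)" by simp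
    moreover have "0 < 1 - (norm (x 0))\<^sup>2" using x[of 0] by (simp add: power_less_one_iff abs_square_less_1)
    ultimately have "0 < 1 - (norm q)\<^sup>2" by (simp add: zero_less_mult_iff)
    then show ?thesis using abs_square_less_1[of "norm q"] by simp
  qed
  have gq: "good q R"
    unfolding good_def
  proof (intro conjI allI impI q1)
    fix t :: real assume t: "0 \<le> t"
    show "R \<le> kappa q (x t)"
      using ineq[OF t] one_minus_herm_ne[OF x[OF t] q1] by (simp add: kappa_def pos_le_divide_eq)
  qed
  have uniq: "d = q" if d: "good d R" for d
  proof (rule ccontr)
    assume "d \<noteq> q"
    then obtain m k where m: "m \<in> ball 0 1" "k > 1"
      "\<And>x R. x \<in> ball 0 1 \<Longrightarrow> R > 0 \<Longrightarrow> kappa d x \<ge> R \<Longrightarrow> kappa q x \<ge> R \<Longrightarrow> kappa m x \<ge> k * R"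
      using kappa_midpoint[of d q] d q1 unfolding good_def by blast
    have "good m (k * R)" using m(1) m(3)[OF x R0] d gq by (auto simp: good_def)
    then have "k * R \<le> R" using cSup_upper[OF _ bdd, of "k * R"] unfolding R_def by blast
    with m(2) R0 show False by simp
  qed
  have "\<Phi> s q = q" if s: "0 \<le> s" for s
  proof (rule uniq, unfold good_def, intro conjI allI impI)
    show "\<Phi> s q \<in> ball 0 1" using HolD(2)[OF H(1)[OF s] q1] .
    fix t :: real assume t: "0 \<le> t"
    \<comment> \<open>Adding enough periods before subtracting \<open>s\<close> keeps the time
      nonnegative, so every orbit point is an image under \<open>\<Phi> s\<close> of an orbit point.
      The Schwarz-Pick inequality then shows that \<open>\<Phi> s q\<close> is as good a centre as
      \<open>q\<close>.\<close>
    obtain n where n: "s \<le> real n" using real_arch_simple by blast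
    have "x t = x (s + (t + real n - s))" using per[OF t, of n] by simp
    also have "\<dots> = \<Phi> s (x (t + real n - s))"
      unfolding x_def using s t n a(1) by (intro H(3)) auto
    finally have "kappa (\<Phi> s q) (x t) \<ge> kappa q (x (t + real n - s))"
      using schwarz_pick[OF H(1)[OF s] q1 x[of "t + real n - s"]] t n by simp
    moreover have "kappa q (x (t + real n - s)) \<ge> R" using gq t n by (simp add: good_def)
    ultimately show "R \<le> kappa (\<Phi> s q) (x t)" by simp
  qed
  with q1 show ?thesis by (rule that)
qed


subsection \<open>Generators of matrix semigroups\<close>

lemma bounded_bilinear_matrix_mult:
  "bounded_bilinear ((**) :: complex^'n^'m \<Rightarrow> complex^'p^'n \<Rightarrow> _)"
  unfolding bilinear_conv_bounded_bilinear[symmetric] bilinear_def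
  by (auto intro!: linearI simp: Finite_Cartesian_Product.vec_eq_iff matrix_matrix_mult_def
      sum.distrib scaleR_sum_right algebra_simps)

lemma bounded_bilinear_matrix_vector_mult:
  "bounded_bilinear ((*v) :: complex^'n^'m \<Rightarrow> complex^'n \<Rightarrow> _)"
  unfolding bilinear_conv_bounded_bilinear[symmetric] bilinear_def
  by (auto intro!: linearI simp: Finite_Cartesian_Product.vec_eq_iff matrix_vector_mult_def
      sum.distrib scaleR_sum_right algebra_simps)

lemma matrix_entry: "A $h i $h j = (A *v axis j 1) $h i" for A :: "complex^'n^'m"
  by (simp add: matrix_vector_mult_def axis_def if_distrib cong: if_cong)

text \<open>The norm on this matrix type is the Frobenius norm, so contractions are bounded by a
  dimensional constant rather than by 1.\<close>

lemma norm_matrix_le_contraction: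
  fixes A :: "complex^'n^'n"
  assumes "\<And>z. norm (A *v z) \<le> norm z"
  shows "norm A \<le> real CARD('n) * real CARD('n)"
proof -
  have e: "cmod (A $h i $h j) \<le> 1" for i j
    unfolding matrix_entry
    using order_trans[OF Finite_Cartesian_Product.norm_nth_le assms, of "axis j 1" i] by simp
  have "norm A \<le> (\<Sum>i\<in>UNIV. norm (A $h i))" unfolding norm_vec_def by (rule L2_set_le_sum) simp
  also have "\<dots> \<le> (\<Sum>i\<in>(UNIV::'n set). \<Sum>j\<in>(UNIV::'n set). 1)"
  proof (rule sum_mono)
    fix i
    have "norm (A $h i) \<le> (\<Sum>j\<in>UNIV. cmod (A $h i $h j))" unfolding norm_vec_def by (rule L2_set_le_sum) simp
    also have "\<dots> \<le> (\<Sum>j\<in>(UNIV::'n set). 1)" by (intro sum_mono e)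
    finally show "norm (A $h i) \<le> (\<Sum>j\<in>(UNIV::'n set). 1)" .
  qed
  finally show ?thesis by simp
qed

abbreviation Imat :: "complex^'n^'n" where "Imat \<equiv> Finite_Cartesian_Product.mat 1"

text \<open>The integral \<open>W h\<close> of a contraction semigroup \<open>B\<close> over a short interval is invertible, and
  \<open>B t ** W h = W (t + h) - W t\<close> is differentiable in \<open>t\<close>.\<close>
lemma matrix_semigroup_generator:
  fixes B :: "real \<Rightarrow> complex^'n^'n"
  assumes B0: "B 0 = Imat"
    and add: "\<And>t s. 0 \<le> t \<Longrightarrow> 0 \<le> s \<Longrightarrow> B (t + s) = B t ** B s"
    and lim: "(B \<longlongrightarrow> Imat) (at_right 0)"
    and contr: "\<And>t z. 0 \<le> t \<Longrightarrow> norm (B t *v z) \<le> norm z"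
  obtains X where "\<And>t. 0 \<le> t \<Longrightarrow> (B has_vector_derivative B t ** X) (at t within {0..})"
proof -
  define C where "C = real CARD('n) * real CARD('n)"
  have C: "norm (B t) \<le> C" if "0 \<le> t" for t
    unfolding C_def by (rule norm_matrix_le_contraction[OF contr[OF that]])
  have C0: "0 < C" by (simp add: C_def)
  have "\<exists>K>0. \<forall>(A :: complex^'n^'n) (A' :: complex^'n^'n). norm (A ** A') \<le> norm A * norm A' * K"
    by (rule bounded_bilinear.pos_bounded[OF bounded_bilinear_matrix_mult])
  then obtain K where K: "0 < K" "\<forall>(A :: complex^'n^'n) (A' :: complex^'n^'n). norm (A ** A') \<le> norm A * norm A' * K"
    by blast
  have near: "\<exists>d>0. \<forall>h. 0 \<le> h \<and> h < d \<longrightarrow> norm (B h - Imat) < \<epsilon>" if "0 < \<epsilon>" for \<epsilon>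
  proof -
    have "\<forall>\<^sub>F h in at_right 0. dist (B h) Imat < \<epsilon>" by (rule tendstoD[OF lim that])
    then obtain b where b: "b > 0" "\<And>h. 0 < h \<Longrightarrow> h < b \<Longrightarrow> dist (B h) Imat < \<epsilon>"
      unfolding eventually_at_right_field by auto
    then have "norm (B h - Imat) < \<epsilon>" if "0 \<le> h" "h < b" for h
      using that \<open>0 < \<epsilon>\<close> B0 by (cases "h = 0") (auto simp: dist_norm)
    with b(1) show ?thesis by blast
  qed
  \<comment> \<open>The factorisation \<open>B s - B t = B t ** (B (s - t) - Imat)\<close> and the
    uniform bound on \<open>B t\<close> turn the one-sided limit at 0 into two-sided continuity on
    all of \<open>{0..}\<close>.\<close>
  have step: "norm (B s - B t) \<le> C * norm (B (s - t) - Imat) * K" if "0 \<le> t" "t \<le> s" for t s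
  proof -
    have "B s = B t ** B (s - t)" using add[of t "s - t"] that by simp
    then have "B s - B t = B t ** (B (s - t) - Imat)"
      by (simp add: bounded_bilinear.diff_right[OF bounded_bilinear_matrix_mult])
    then have "norm (B s - B t) \<le> norm (B t) * norm (B (s - t) - Imat) * K"
      using K(2)[rule_format, of "B t" "B (s - t) - Imat"] by simp
    also have "\<dots> \<le> C * norm (B (s - t) - Imat) * K"
      using C[OF that(1)] K(1) by (intro mult_right_mono) auto
    finally show ?thesis .
  qed
  have cont: "continuous_on {0..} B"
    unfolding continuous_on_iff
  proof (intro ballI allI impI)
    fix t \<epsilon> :: real assume "t \<in> {0..}" and \<epsilon>: "0 < \<epsilon>"
    obtain d where d: "d > 0" "\<And>h. 0 \<le> h \<Longrightarrow> h < d \<Longrightarrow> norm (B h - Imat) < \<epsilon> / (C * K)"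
      using near[of "\<epsilon> / (C * K)"] \<epsilon> C0 K(1) by auto
    have close: "norm (B b - B a) < \<epsilon>" if "0 \<le> a" "a \<le> b" "b - a < d" for a b
    proof -
      have "norm (B b - B a) \<le> C * norm (B (b - a) - Imat) * K" by (rule step[OF that(1,2)])
      also have "\<dots> < \<epsilon>" using d(2)[of "b - a"] that C0 K(1) by (simp add: field_simps)
      finally show ?thesis .
    qed
    have "dist (B s) (B t) < \<epsilon>" if "s \<in> {0..}" "dist s t < d" for s
      using close[of s t] close[of t s] that \<open>t \<in> {0..}\<close>
      by (cases "s \<le> t") (auto simp: dist_norm norm_minus_commute)
    with d(1) show "\<exists>d>0. \<forall>s\<in>{0..}. dist s t < d \<longrightarrow> dist (B s) (B t) < \<epsilon>" by blast
  qed
  have contI: "continuous_on {a..b} B" if "0 \<le> a" for a b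
    using that by (intro continuous_on_subset[OF cont]) auto
  define W where "W t = integral {0..t} B" for t
  have W': "(W has_vector_derivative B t) (at t within {0..})" if t: "0 \<le> t" for t
  proof -
    have "(W has_vector_derivative B t) (at t within {0..t+1})"
      unfolding W_def using t by (intro integral_has_vector_derivative contI) auto
    moreover have "at t within {0..t+1} = at t within {0..}"
      by (rule at_within_nhd[of t "{..<t+1}"]) auto
    ultimately show ?thesis by simp
  qed
  have "\<exists>K>0. \<forall>(A :: complex^'n^'n) (z :: complex^'n). norm (A *v z) \<le> norm A * norm z * K"
    by (rule bounded_bilinear.pos_bounded[OF bounded_bilinear_matrix_vector_mult])
  then obtain K' where K': "0 < K'" "\<forall>(A :: complex^'n^'n) (z :: complex^'n). norm (A *v z) \<le> norm A * norm z * K'"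
    by blast
  \<comment> \<open>The threshold \<open>1 / (2 * K')\<close> keeps \<open>W h\<close> so close to
    \<open>h *\<^sub>R Imat\<close> that a kernel vector \<open>z\<close> would satisfy
    \<open>h * norm z \<le> h * norm z / 2\<close>.\<close>
  obtain d where d: "d > 0" "\<And>h. 0 \<le> h \<Longrightarrow> h < d \<Longrightarrow> norm (B h - Imat) < 1 / (2 * K')"
    using near[of "1 / (2 * K')"] K'(1) by auto
  define h where "h = d / 2"
  have h: "0 < h" "h < d" using d(1) by (simp_all add: h_def)
  have "W h - h *\<^sub>R Imat = integral {0..h} (\<lambda>s. B s - Imat)"
    unfolding W_def using h contI[of 0 h]
    by (subst Henstock_Kurzweil_Integration.integral_diff) (auto intro!: integrable_continuous_real)
  also have "norm \<dots> \<le> integral {0..h} (\<lambda>s. 1 / (2 * K'))"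
    using h d(2) contI[of 0 h]
    by (intro Henstock_Kurzweil_Integration.integral_norm_bound_integral)
       (auto intro!: integrable_continuous_real continuous_intros less_imp_le)
  also have "\<dots> = h / (2 * K')" using h by simp
  finally have Wh: "norm (W h - h *\<^sub>R Imat) \<le> h / (2 * K')" .
  have "z = 0" if "W h *v z = 0" for z
  proof (rule ccontr)
    assume z: "z \<noteq> 0"
    have "(W h - h *\<^sub>R Imat) *v z = - (h *\<^sub>R z)"
      using that by (simp add: bounded_bilinear.diff_left[OF bounded_bilinear_matrix_vector_mult]
          bounded_bilinear.scaleR_left[OF bounded_bilinear_matrix_vector_mult])
    then have "h * norm z \<le> norm (W h - h *\<^sub>R Imat) * norm z * K'"
      using K'(2)[rule_format, of "W h - h *\<^sub>R Imat" z] h by simp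
    also have "\<dots> \<le> h / (2 * K') * norm z * K'"
      using Wh K'(1) by (intro mult_right_mono) auto
    also have "\<dots> = h * norm z / 2" using K'(1) by simp
    finally show False using h z by simp
  qed
  then obtain Y where "Y ** W h = Imat" using matrix_left_invertible_ker[of "W h"] by blast
  then have Y: "W h ** Y = Imat" using matrix_left_right_inverse by blast
  have BW: "B t ** W h = W (t + h) - W t" if t: "0 \<le> t" for t
  proof -
    have "B t ** W h = integral {0..h} ((\<lambda>A. B t ** A) \<circ> B)"
      unfolding W_def using contI[of 0 h]
      by (intro integral_linear[symmetric] integrable_continuous_real
          bounded_bilinear.bounded_linear_right[OF bounded_bilinear_matrix_mult]) auto
    also have "\<dots> = integral {0..h} (B \<circ> (\<lambda>x. x + t))"
      using add[OF t] by (intro Henstock_Kurzweil_Integration.integral_cong) (auto simp: add.commute)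
    also have "\<dots> = integral {0+t..h+t} B"
      using t by (intro integral_shift contI) auto
    also have "\<dots> = W (t + h) - W t"
      unfolding W_def using Henstock_Kurzweil_Integration.integral_combine[of 0 t "t + h" B] t h contI[of 0 "t + h"]
      by (simp add: integrable_continuous_real add.commute algebra_simps)
    finally show ?thesis .
  qed
  have BY: "B t = (W (t + h) - W t) ** Y" if "0 \<le> t" for t
    using BW[OF that] Y by (metis matrix_mul_assoc matrix_mul_rid)
  \<comment> \<open>Differentiating \<open>BY\<close> gives \<open>(B (t + h) - B t) ** Y\<close>;
    factoring out \<open>B t\<close> on the left leaves this matrix, which is independent of
    \<open>t\<close>.\<close>
  define X where "X = (B h - Imat) ** Y"
  have "(B has_vector_derivative B t ** X) (at t within {0..})" if t: "0 \<le> t" for t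
  proof -
    have "((\<lambda>t. t + h) has_vector_derivative 1) (at t within {0..})"
      by (auto intro!: derivative_eq_intros)
    moreover have "(W has_vector_derivative B (t + h)) (at (t + h) within (\<lambda>t. t + h) ` {0..})"
      using t h by (intro has_vector_derivative_within_subset[OF W']) auto
    ultimately have "(W \<circ> (\<lambda>t. t + h) has_vector_derivative 1 *\<^sub>R B (t + h)) (at t within {0..})"
      by (rule vector_diff_chain_within)
    then have "((\<lambda>t. W (t + h) - W t) has_vector_derivative B (t + h) - B t) (at t within {0..})"
      using W'[OF t] by (intro has_vector_derivative_diff) (auto simp: o_def)
    from bounded_linear.has_vector_derivative[OF bounded_bilinear.bounded_linear_left[OF bounded_bilinear_matrix_mult, of Y] this]
    have "((\<lambda>t. (W (t + h) - W t) ** Y) has_vector_derivative (B (t + h) - B t) ** Y) (at t within {0..})" .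
    moreover have "(B (t + h) - B t) ** Y = B t ** X"
      unfolding X_def using add[OF t, of h] h
      by (simp add: matrix_mul_assoc bounded_bilinear.diff_right[OF bounded_bilinear_matrix_mult])
    ultimately show ?thesis
      using BY t by (auto intro: has_vector_derivative_transform[rotated 2])
  qed
  then show ?thesis by (rule that)
qed

section \<open>Convergence of derivatives as time tends to 0\<close>

text \<open>The compact-open topology controls the image of each small piece of \<open>K\<close>.
  Finitely many pieces cover \<open>K\<close>, and the radii \<open>\<epsilon> / 4\<close> and
  \<open>\<epsilon> / 2\<close> add up to less than \<epsilon> in the triangle inequality.\<close>

lemma semigroup_on_eventually_uniform:
  fixes \<Phi> :: "real \<Rightarrow> complex^'n \<Rightarrow> complex^'n"
  assumes \<Phi>: "semigroup_on D \<Phi>" and K: "compact K" "K \<subseteq> D" and \<epsilon>: "0 < \<epsilon>"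
  shows "\<forall>\<^sub>F t in at_right 0. \<forall>z\<in>K. dist (\<Phi> t z) z < \<epsilon>"
proof -
  have "K \<subseteq> (\<Union>z\<in>K. ball z (\<epsilon> / 4))" using \<epsilon> by (intro subsetI UN_I) auto
  then obtain F where F: "F \<subseteq> K" "finite F" "K \<subseteq> (\<Union>z\<in>F. ball z (\<epsilon> / 4))"
    using compactE_image[OF K(1), of K "\<lambda>z. ball z (\<epsilon> / 4)"] open_ball by metis
  have "\<forall>\<^sub>F t in at_right 0. \<Phi> t ` (K \<inter> cball z (\<epsilon> / 4)) \<subseteq> ball z (\<epsilon> / 2)" for z
  proof -
    let ?S = "{t \<in> {0..}. \<Phi> t ` (K \<inter> cball z (\<epsilon> / 4)) \<subseteq> ball z (\<epsilon> / 2)}"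
    have "openin (top_of_set {0..}) ?S"
      using K by (intro semigroup_on_openin[OF \<Phi>]) auto
    then obtain T where T: "open T" "?S = {0..} \<inter> T" by (auto simp: openin_open)
    have "\<Phi> 0 w \<in> ball z (\<epsilon> / 2)" if "w \<in> K" "dist z w \<le> \<epsilon> / 4" for w
      using semigroup_onD(2)[OF \<Phi>, of w] that K(2) \<epsilon> by auto
    then have "0 \<in> ?S" by (simp add: image_subset_iff)
    then have "\<forall>\<^sub>F t in at_right 0. t \<in> T" using T by (auto simp: eventually_at_topological)
    moreover have "\<forall>\<^sub>F t in at_right 0. (t::real) > 0" by (rule eventually_at_right_less)
    ultimately show ?thesis
    proof eventually_elim
      case (elim t)
      then have "t \<in> {0..} \<inter> T" by simp
      then show ?case unfolding T(2)[symmetric] by simp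
    qed
  qed
  then have "\<forall>\<^sub>F t in at_right 0. \<forall>z\<in>F. \<Phi> t ` (K \<inter> cball z (\<epsilon> / 4)) \<subseteq> ball z (\<epsilon> / 2)"
    using F(2) by (simp add: eventually_ball_finite)
  then show ?thesis
  proof eventually_elim
    case (elim t)
    show ?case
    proof
      fix w assume w: "w \<in> K"
      then obtain z where z: "z \<in> F" "dist z w < \<epsilon> / 4" using F(3) by auto
      then have "dist z (\<Phi> t w) < \<epsilon> / 2" using elim w by (auto simp: image_subset_iff)
      with z(2) show "dist (\<Phi> t w) w < \<epsilon>"
        using dist_triangle[of "\<Phi> t w" w z] \<epsilon> by (simp add: dist_commute)
    qed
  qed
qed

text \<open>Cauchy's inequality on a disc of radius \<open>r\<close> bounds the derivative of each
  slice of \<open>\<Phi> t z - z\<close> at \<open>q\<close> by its supremum over \<open>r\<close>,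
  so uniform closeness to the identity on \<open>cball q r\<close> passes to the
  derivatives.\<close>

lemma semigroup_on_derivative_tendsto:
  fixes \<Phi> :: "real \<Rightarrow> complex^'n \<Rightarrow> complex^'n"
  assumes \<Phi>: "semigroup_on D \<Phi>" and q: "q \<in> D" and D: "open D"
    and C: "\<And>t. 0 \<le> t \<Longrightarrow> (\<Phi> t has_derivative (*v) (C t)) (at q)"
  shows "(C \<longlongrightarrow> Imat) (at_right 0)"
proof -
  obtain r where r: "0 < r" "cball q r \<subseteq> D" using D q open_contains_cball by blast
  have est: "norm (C t *v v - v) \<le> \<epsilon> / r"
    if t: "0 \<le> t" and close: "\<forall>z\<in>cball q r. dist (\<Phi> t z) z < \<epsilon>" and v: "norm v = 1" for t \<epsilon> v
  proof -
    define f where "f z = \<Phi> t z - z" for z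
    obtain w where w: "norm w = 1" "C t *v v - v = of_real (norm (C t *v v - v)) *s w"
      by (rule norm_vec_direction)
    let ?g = "\<lambda>\<zeta>. herm (f (q + \<zeta> *s v)) w"
    have diff: "(f has_derivative (*v) (A - Imat)) (at z)" if "(\<Phi> t has_derivative (*v) A) (at z)" for A z
    proof -
      have "(*v) (A - Imat) = (\<lambda>v. A *v v - v)"
        by (auto simp: bounded_bilinear.diff_left[OF bounded_bilinear_matrix_vector_mult])
      then show ?thesis unfolding f_def using that by (auto intro!: derivative_eq_intros)
    qed
    have g': "\<exists>d. (?g has_field_derivative d) (at \<zeta>)" if "norm \<zeta> \<le> r" for \<zeta>
    proof -
      have "q + \<zeta> *s v \<in> D" using that v r(2) by (auto simp: subset_iff dist_norm)
      then obtain A where "(\<Phi> t has_derivative (*v) A) (at (q + \<zeta> *s v))"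
        using HolD(1)[OF semigroup_onD(1)[OF \<Phi> t]] unfolding holo_on_iff_matrix by blast
      from has_field_derivative_slice[OF diff[OF this], of w] show ?thesis by blast
    qed
    have "norm ((deriv ^^ 1) ?g 0) \<le> fact 1 * \<epsilon> / r ^ 1"
    proof (rule Cauchy_inequality)
      show "?g holomorphic_on ball 0 r" using g' by (auto simp: holomorphic_on_open)
      show "continuous_on (cball 0 r) ?g"
      proof (intro continuous_at_imp_continuous_on ballI)
        fix x assume "x \<in> cball (0::complex) r"
        then obtain d where "(?g has_field_derivative d) (at x)" using g'[of x] by auto
        then show "isCont ?g x" by (rule DERIV_isCont)
      qed
      show "norm (?g x) \<le> \<epsilon>" if "norm (0 - x) = r" for x
      proof -
        have "q + x *s v \<in> cball q r" using that v by (simp add: dist_norm)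
        then have "norm (f (q + x *s v)) < \<epsilon>" using close by (auto simp: f_def dist_norm)
        then show ?thesis using norm_herm_le[of "f (q + x *s v)" w] w(1) by simp
      qed
    qed (rule r(1))
    moreover have "(f has_derivative (*v) (C t - Imat)) (at (q + 0 *s v))"
      using diff[OF C[OF t]] by simp
    from DERIV_imp_deriv[OF has_field_derivative_slice[OF this, of w]]
    have "deriv ?g 0 = herm ((C t - Imat) *v v) w" .
    moreover have "(C t - Imat) *v v = C t *v v - v"
      by (simp add: bounded_bilinear.diff_left[OF bounded_bilinear_matrix_vector_mult])
    ultimately show ?thesis using herm_direction[OF w(2,1)] by simp
  qed
  show ?thesis
  proof (intro vec_tendstoI tendstoI)
    fix i j :: 'n and \<epsilon> :: real assume \<epsilon>: "0 < \<epsilon>"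
    have "\<forall>\<^sub>F t in at_right 0. \<forall>z\<in>cball q r. dist (\<Phi> t z) z < r * \<epsilon> / 2"
      using r \<epsilon> by (intro semigroup_on_eventually_uniform[OF \<Phi>]) auto
    moreover have "\<forall>\<^sub>F t in at_right 0. (t::real) > 0" by (rule eventually_at_right_less)
    ultimately show "\<forall>\<^sub>F t in at_right 0. dist (C t $h i $h j) (Imat $h i $h j) < \<epsilon>"
    proof eventually_elim
      case (elim t)
      have "norm (C t *v axis j 1 - axis j 1) \<le> \<epsilon> / 2"
        using est[of t "r * \<epsilon> / 2" "axis j 1"] elim r(1) by simp
      moreover have "dist (C t $h i $h j) (Imat $h i $h j) = cmod ((C t *v axis j 1 - axis j 1) $h i)"
        by (simp add: dist_norm matrix_entry[of _ i j])
      moreover have "cmod ((C t *v axis j 1 - axis j 1) $h i) \<le> norm (C t *v axis j 1 - axis j 1)"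
        by (rule Finite_Cartesian_Product.norm_nth_le)
      ultimately show ?case using \<epsilon> by linarith
    qed
  qed
qed


subsection \<open>Linearization at the common fixed point\<close>

text \<open>The involution is built from \<open>p\<close>, \<open>z\<close> and
  \<open>herm z p\<close> alone, so a linear map that fixes \<open>p\<close> and preserves the
  pairing with \<open>p\<close> commutes with it.\<close>

lemma ball_moebius_commute:
  assumes "L *v p = p" "\<And>z. herm (L *v z) p = herm z p"
  shows "ball_moebius p (L *v z) = L *v ball_moebius p z"
  by (simp only: ball_moebius_def Let_def assms vector_scalar_commute matrix_vector_mult_diff_distrib)

lemma matrix_derivative_unique:
  assumes "(f has_derivative (*v) (A :: complex^'n^'m)) (at z)" "(f has_derivative (*v) B) (at z)"
  shows "A = B"
proof -
  have "(*v) A = (*v) B" by (rule has_derivative_unique[OF assms])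
  then show ?thesis by (simp add: matrix_eq fun_eq_iff)
qed

text \<open>\<open>B t\<close> is the derivative at 0 of
  \<open>S \<circ> \<Phi> t \<circ> R\<close>, a self-map fixing 0, hence a contraction by the
  Schwarz lemma. It is multiplicative because the derivatives of \<open>S\<close> and
  \<open>R\<close> are inverse matrices: in finite dimension \<open>P ** T = Imat\<close> gives
  \<open>T ** P = Imat\<close>.\<close>

lemma semigroup_on_linearization:
  fixes \<Phi> :: "real \<Rightarrow> complex^'n \<Rightarrow> complex^'n" and L :: "complex^'n^'n"
  assumes \<Phi>: "semigroup_on (ball 0 1) \<Phi>" and q: "q \<in> ball 0 1" "\<And>t. 0 \<le> t \<Longrightarrow> \<Phi> t q = q"
    and S: "S \<in> Hol (ball 0 1)" "S q = 0" and R: "R \<in> Hol (ball 0 1)" "R 0 = q"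
    and SR: "\<And>z. z \<in> ball 0 1 \<Longrightarrow> S (R z) = z"
    and L: "\<And>z. z \<in> ball 0 1 \<Longrightarrow> S (\<Phi> 1 (R z)) = L *v z"
  obtains B :: "real \<Rightarrow> complex^'n^'n" where "B 0 = Imat" "\<And>t s. 0 \<le> t \<Longrightarrow> 0 \<le> s \<Longrightarrow> B (t + s) = B t ** B s"
    "(B \<longlongrightarrow> Imat) (at_right 0)" "\<And>t z. 0 \<le> t \<Longrightarrow> norm (B t *v z) \<le> norm z" "B 1 = L"
proof -
  note H = semigroup_onD[OF \<Phi>]
  have id: "((\<lambda>z. z) has_derivative (*v) (Imat :: complex^'n^'n)) (at z)" for z
  proof -
    have "(*v) (Imat :: complex^'n^'n) = (\<lambda>z. z)" by auto
    then show ?thesis by simp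
  qed
  obtain P where P: "(S has_derivative (*v) P) (at q)"
    using HolD(1)[OF S(1)] q(1) unfolding holo_on_iff_matrix by blast
  have "(0 :: complex^'n) \<in> ball 0 1" by simp
  then obtain T where T: "(R has_derivative (*v) T) (at 0)"
    using HolD(1)[OF R(1)] unfolding holo_on_iff_matrix by blast
  have "\<forall>t. \<exists>A. 0 \<le> t \<longrightarrow> (\<Phi> t has_derivative (*v) A) (at q)"
    using HolD(1)[OF H(1)] q(1) unfolding holo_on_iff_matrix by blast
  then obtain C where C: "\<And>t. 0 \<le> t \<Longrightarrow> (\<Phi> t has_derivative (*v) (C t)) (at q)" by metis
  have C0: "C 0 = Imat"
  proof (rule matrix_derivative_unique[OF C])
    show "(\<Phi> 0 has_derivative (*v) Imat) (at q)"
      by (rule has_derivative_transform_within_open[OF id, of "ball 0 1"]) (use q(1) H(2) in auto)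
  qed simp
  have Cadd: "C (t + s) = C t ** C s" if "0 \<le> t" "0 \<le> s" for t s
  proof (rule matrix_derivative_unique[OF C])
    have "((\<lambda>z. \<Phi> t (\<Phi> s z)) has_derivative (*v) (C t ** C s)) (at q)"
      using that C q(2) by (intro has_derivative_matrix_compose) auto
    then show "(\<Phi> (t + s) has_derivative (*v) (C t ** C s)) (at q)"
      by (rule has_derivative_transform_within_open[of _ _ _ _ "ball 0 1"]) (use q(1) H(3) that in auto)
  qed (use that in simp)
  have PT: "P ** T = Imat"
  proof (rule matrix_derivative_unique)
    show "((\<lambda>z. S (R z)) has_derivative (*v) (P ** T)) (at 0)"
      using T P R(2) by (intro has_derivative_matrix_compose) auto
    show "((\<lambda>z. S (R z)) has_derivative (*v) Imat) (at 0)"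
      by (rule has_derivative_transform_within_open[OF id, of "ball 0 1"]) (use SR in auto)
  qed
  then have TP: "T ** P = Imat" using matrix_left_right_inverse by blast
  define B where "B t = P ** C t ** T" for t
  have B': "((\<lambda>z. S (\<Phi> t (R z))) has_derivative (*v) (B t)) (at 0)" if "0 \<le> t" for t
  proof -
    have "((\<lambda>z. \<Phi> t (R z)) has_derivative (*v) (C t ** T)) (at 0)"
      using T C[OF that] R(2) by (intro has_derivative_matrix_compose) auto
    then have "((\<lambda>z. S (\<Phi> t (R z))) has_derivative (*v) (P ** (C t ** T))) (at 0)"
      by (rule has_derivative_matrix_compose) (use P R(2) q(2)[OF that] in simp)
    then show ?thesis by (simp add: B_def matrix_mul_assoc)
  qed
  show ?thesis
  proof (rule that[of B])
    show "B 0 = Imat" by (simp add: B_def C0 PT)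
    show "B (t + s) = B t ** B s" if "0 \<le> t" "0 \<le> s" for t s
    proof -
      have "B t ** B s = P ** C t ** (T ** P) ** C s ** T" by (simp add: B_def matrix_mul_assoc)
      also have "\<dots> = B (t + s)" unfolding TP B_def Cadd[OF that] by (simp add: matrix_mul_assoc)
      finally show ?thesis ..
    qed
    have "(C \<longlongrightarrow> Imat) (at_right 0)"
      by (rule semigroup_on_derivative_tendsto[OF \<Phi> q(1) open_ball C])
    then have "((\<lambda>t. P ** C t ** T) \<longlongrightarrow> P ** Imat ** T) (at_right 0)"
      by (intro bounded_bilinear.tendsto[OF bounded_bilinear_matrix_mult] tendsto_const)
    then show "(B \<longlongrightarrow> Imat) (at_right 0)" by (simp add: B_def[abs_def] PT)
    show "norm (B t *v z) \<le> norm z" if t: "0 \<le> t" for t z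
    proof (rule schwarz_ball_derivative[OF _ _ B'[OF t]])
      show "(\<lambda>z. S (\<Phi> t (R z))) \<in> Hol (ball 0 1)"
        by (rule Hol_compose[OF Hol_compose[OF R(1) H(1)[OF t]] S(1)])
      show "S (\<Phi> t (R 0)) = 0" using S(2) R(2) q(2)[OF t] by simp
    qed
    have "((*v) L has_derivative (*v) L) (at 0)"
      by (rule bounded_linear_imp_has_derivative) simp
    then have "((\<lambda>z. S (\<Phi> 1 (R z))) has_derivative (*v) L) (at 0)"
      by (rule has_derivative_transform_within_open[of _ _ _ _ "ball 0 1"]) (use L in auto)
    with B'[of 1] show "B 1 = L" using matrix_derivative_unique by auto
  qed
qed

lemma inner_herm: "inner z w = Re (herm z w)"
  by (simp add: inner_vec_def inner_complex_def herm_def)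

text \<open>The function \<open>(norm (B t *v w))\<^sup>2\<close> has its maximum at
  \<open>t = 0\<close>, so its right derivative there, twice the real part in question, is at most
  0.\<close>

lemma contraction_generator_dissipative:
  fixes B :: "real \<Rightarrow> complex^'n^'n"
  assumes B0: "B 0 = Imat" and contr: "\<And>t z. 0 \<le> t \<Longrightarrow> norm (B t *v z) \<le> norm z"
    and X: "(B has_vector_derivative X) (at 0 within {0..})"
  shows "Re (herm (X *v w) w) \<le> 0"
proof -
  have "((\<lambda>t. B t *v w) has_vector_derivative X *v w) (at 0 within {0..})"
    by (rule bounded_linear.has_vector_derivative[OF
          bounded_bilinear.bounded_linear_left[OF bounded_bilinear_matrix_vector_mult] X])
  from bounded_bilinear.has_vector_derivative[OF bounded_bilinear_inner this this]
  have "((\<lambda>t. inner (B t *v w) (B t *v w)) has_vector_derivative 2 * inner (X *v w) w) (at 0 within {0..})"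
    by (simp add: B0 inner_commute)
  then have "((\<lambda>t. (norm (B t *v w))\<^sup>2) has_field_derivative 2 * inner (X *v w) w) (at 0 within {0..})"
    by (simp add: has_real_derivative_iff_has_vector_derivative dot_square_norm)
  then have "((\<lambda>t. (norm (B t *v w))\<^sup>2) has_field_derivative 2 * inner (X *v w) w) (at_right 0)"
    by (rule DERIV_subset) auto
  then have "((\<lambda>t. ((norm (B t *v w))\<^sup>2 - (norm w)\<^sup>2) / t) \<longlongrightarrow> 2 * inner (X *v w) w) (at_right 0)"
    by (simp add: has_field_derivative_iff B0)
  moreover have "\<forall>\<^sub>F t in at_right 0. ((norm (B t *v w))\<^sup>2 - (norm w)\<^sup>2) / t \<le> 0"
    using eventually_at_right_less[of "0::real"]
  proof eventually_elim
    case (elim t)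
    then have "(norm (B t *v w))\<^sup>2 \<le> (norm w)\<^sup>2" using contr[of t w] by (intro power_mono) auto
    with elim show ?case by (simp add: divide_nonpos_pos)
  qed
  ultimately have "2 * inner (X *v w) w \<le> 0"
    by (intro tendsto_upperbound) auto
  then show ?thesis by (simp add: inner_herm)
qed


subsection \<open>Block coordinates\<close>

lemma unitary_diagonal_norm:
  assumes "\<Lambda> \<in> carrier_mat u u" "diagonal_mat \<Lambda>" "unitary_mat \<Lambda>" "i < u"
  shows "cmod (\<Lambda> $$ (i,i)) = 1"
proof -
  have "(mat_adjoint \<Lambda> * \<Lambda>) $$ (i,i) = (\<Sum>l<u. cnj (\<Lambda> $$ (l,i)) * \<Lambda> $$ (l,i))"
    using assms(1,4)
    by (auto simp: mat_adjoint_def mat_of_rows_def scalar_prod_def lessThan_atLeast0 intro!: sum.cong)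
  also have "\<dots> = (\<Sum>l<u. if l = i then of_real ((cmod (\<Lambda> $$ (i,i)))\<^sup>2) else 0)"
    using assms(1,2,4) unfolding complex_norm_square
    by (intro sum.cong) (auto simp: diagonal_mat_def)
  also have "\<dots> = of_real ((cmod (\<Lambda> $$ (i,i)))\<^sup>2)" using assms(4) by simp
  finally have "of_real ((cmod (\<Lambda> $$ (i,i)))\<^sup>2) = (1::complex)"
    using assms(1,3,4) by (auto simp: unitary_mat_def)
  then have "(cmod (\<Lambda> $$ (i,i)))\<^sup>2 = 1" by (simp only: of_real_eq_1_iff)
  then show ?thesis by (simp add: power2_eq_1_iff) (smt (verit) norm_ge_zero)
qed

lemma rho_less_1_eigenvector:
  assumes "A \<in> carrier_mat n n" "rho A < 1" "v \<in> carrier_vec n" "A *\<^sub>v v = c \<cdot>\<^sub>v v" "cmod c = 1"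
  shows "v = 0\<^sub>v n"
proof (rule ccontr)
  assume v: "v \<noteq> 0\<^sub>v n"
  \<comment> \<open>A nonzero vector exists only in positive order, where \<open>rho\<close> is the
    library's spectral radius and not the default value.\<close>
  then have n: "n > 0" using assms(3) by (metis carrier_vecD eq_vecI gr0I index_zero_vec(2) not_less_zero)
  have "c \<in> spectrum A"
    using assms v by (auto simp: spectrum_def eigenvalue_def eigenvector_def)
  then have "1 \<le> spectral_radius A"
    using spectral_radius_mem_max(2)[OF assms(1) n, of "cmod c"] assms(5) by auto
  with assms(1,2) n show False by (simp add: rho_def)
qed

definition coords_tail :: "(nat \<Rightarrow> 'n) \<Rightarrow> nat \<Rightarrow> complex^'n \<Rightarrow> complex Matrix.vec" where
  "coords_tail e u z = Matrix.vec (CARD('n) - u) (\<lambda>j. z $h e (u + j))"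

lemma coords_tail_carrier [simp]: "coords_tail e u (z :: complex^'n) \<in> carrier_vec (CARD('n) - u)"
  by (simp add: coords_tail_def)

lemma coords_tail_index [simp]:
  "j < CARD('n) - u \<Longrightarrow> coords_tail e u (z :: complex^'n) $ j = z $h e (u + j)"
  by (simp add: coords_tail_def)

context
  fixes e :: "nat \<Rightarrow> 'n::finite" and u :: nat
  assumes e: "bij_betw e {..<CARD('n)} UNIV" and u: "u \<le> CARD('n)"
begin

lemma sum_split_coords: "(\<Sum>k\<in>UNIV. f k) = (\<Sum>i<u. f (e i)) + (\<Sum>j<CARD('n) - u. f (e (u + j)))"
proof -
  have "(\<Sum>k\<in>UNIV. f k) = (\<Sum>i<CARD('n). f (e i))"
    by (rule sum.reindex_bij_betw[OF e, symmetric])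
  also have "{..<CARD('n)} = {..<u} \<union> {u..<CARD('n)}" using u by auto
  also have "(\<Sum>i\<in>\<dots>. f (e i)) = (\<Sum>i<u. f (e i)) + (\<Sum>i\<in>{u..<CARD('n)}. f (e i))"
    by (rule sum.union_disjoint) auto
  also have "(\<Sum>i\<in>{u..<CARD('n)}. f (e i)) = (\<Sum>j<CARD('n) - u. f (e (u + j)))"
    using u by (intro sum.reindex_bij_witness[of _ "\<lambda>j. u + j" "\<lambda>i. i - u"]) auto
  finally show ?thesis .
qed

lemma coord_cases:
  obtains (first) i where "i < u" "k = e i" | (last) j where "j < CARD('n) - u" "k = e (u + j)"
proof -
  obtain i where i: "i < CARD('n)" "k = e i" using e by (auto simp: bij_betw_def image_iff)
  show ?thesis
  proof (cases "i < u")
    case False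
    then show ?thesis using i by (intro last[of "i - u"]) auto
  qed (use i first in blast)
qed

lemma coord_vec_eqI:
  assumes "\<And>i. i < u \<Longrightarrow> z $h e i = w $h e i" "\<And>j. j < CARD('n) - u \<Longrightarrow> z $h e (u + j) = w $h e (u + j)"
  shows "z = w"
  unfolding Finite_Cartesian_Product.vec_eq_iff
proof
  fix k show "z $h k = w $h k" by (cases rule: coord_cases[of k]) (auto simp: assms)
qed

lemma coord_inj: "i < CARD('n) \<Longrightarrow> j < CARD('n) \<Longrightarrow> e i = e j \<longleftrightarrow> i = j"
  using e by (auto simp: bij_betw_def inj_on_def)

lemma of_coords_index: "i < CARD('n) \<Longrightarrow> of_coords e v $h e i = v $ i"
  using e by (simp add: of_coords_def inv_into_f_f bij_betw_def)

lemma split_map_first: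
  assumes "\<Lambda> \<in> carrier_mat u u" "diagonal_mat \<Lambda>" "i < u"
  shows "split_map e u \<Lambda> A z $h e i = \<Lambda> $$ (i,i) * z $h e i"
proof -
  have "split_map e u \<Lambda> A z $h e i = (\<Lambda> *\<^sub>v vec_first (to_coords e z) u) $ i"
    using assms u by (simp add: split_map_def of_coords_index)
  also have "\<dots> = (\<Sum>l<u. \<Lambda> $$ (i,l) * z $h e l)"
    using assms u by (subst index_mult_mat_vec_sum[of _ u u]) (auto simp: vec_first_def to_coords_def)
  also have "\<dots> = (\<Sum>l<u. if l = i then \<Lambda> $$ (i,i) * z $h e i else 0)"
    using assms by (intro sum.cong) (auto simp: diagonal_mat_def)
  finally show ?thesis using assms(3) by simp
qed

lemma split_map_last:
  assumes "\<Lambda> \<in> carrier_mat u u" "A \<in> carrier_mat (CARD('n) - u) (CARD('n) - u)" "j < CARD('n) - u"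
  shows "split_map e u \<Lambda> A z $h e (u + j) = (A *\<^sub>v coords_tail e u z) $ j"
proof -
  have "vec_last (to_coords e z) (CARD('n) - u) = coords_tail e u z"
    using u by (intro eq_vecI) (auto simp: vec_last_def to_coords_def coords_tail_def)
  then show ?thesis using assms u by (simp add: split_map_def of_coords_index)
qed

lemma split_map_matrix:
  assumes "\<Lambda> \<in> carrier_mat u u" "diagonal_mat \<Lambda>" "A \<in> carrier_mat (CARD('n) - u) (CARD('n) - u)"
  obtains L where "\<And>z. split_map e u \<Lambda> A z = L *v z"
proof -
  note ix = split_map_first[OF assms(1,2)] split_map_last[OF assms(1,3)]
    index_mult_mat_vec_sum[OF assms(3) coords_tail_carrier]
  have "\<exists>L. \<forall>z. split_map e u \<Lambda> A z = L *v z"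
    by (rule complex_linear_matrix; rule coord_vec_eqI)
       (simp_all add: ix distrib_left sum.distrib sum_distrib_left mult.left_commute del: index_mult_mat_vec)
  then show ?thesis using that by blast
qed

text \<open>The tail of a unimodular eigenvector would be one of \<open>A\<close>, and the spectral
  radius leaves only 0. This serves twice: for the block triangularity of \<open>B t\<close> and,
  with \<open>c = 1\<close>, for the position of a fixed point.\<close>

lemma split_map_eigenvector_tail:
  assumes "\<Lambda> \<in> carrier_mat u u" and A: "A \<in> carrier_mat (CARD('n) - u) (CARD('n) - u)" "rho A < 1"
    and y: "split_map e u \<Lambda> A y = c *s y" "cmod c = 1" and j: "j < CARD('n) - u"
  shows "y $h e (u + j) = 0"
proof -
  have "A *\<^sub>v coords_tail e u y = c \<cdot>\<^sub>v coords_tail e u y"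
  proof (rule eq_vecI)
    fix i assume "i < dim_vec (c \<cdot>\<^sub>v coords_tail e u y)"
    then have i: "i < CARD('n) - u" by (simp add: coords_tail_def)
    then show "(A *\<^sub>v coords_tail e u y) $ i = (c \<cdot>\<^sub>v coords_tail e u y) $ i"
      using split_map_last[OF assms(1) A(1) i, of y] y(1) by (simp add: coords_tail_def)
  qed (use A(1) in \<open>auto simp: coords_tail_def\<close>)
  from rho_less_1_eigenvector[OF A coords_tail_carrier this y(2)]
  have "coords_tail e u y $ j = 0\<^sub>v (CARD('n) - u) $ j" by simp
  with j show ?thesis by simp
qed

lemma generator_of_split_map:
  fixes B :: "real \<Rightarrow> complex^'n^'n"
  assumes \<Lambda>: "\<Lambda> \<in> carrier_mat u u" "diagonal_mat \<Lambda>" "unitary_mat \<Lambda>"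
    and A: "A \<in> carrier_mat (CARD('n) - u) (CARD('n) - u)" "rho A < 1"
    and B: "B 0 = Imat" "\<And>t s. 0 \<le> t \<Longrightarrow> 0 \<le> s \<Longrightarrow> B (t + s) = B t ** B s"
      "(B \<longlongrightarrow> Imat) (at_right 0)" "\<And>t z. 0 \<le> t \<Longrightarrow> norm (B t *v z) \<le> norm z"
    and B1: "\<And>z. B 1 *v z = split_map e u \<Lambda> A z"
  shows "\<exists>M \<in> carrier_mat (CARD('n) - u) (CARD('n) - u).
            dissipative M \<and> spectrum M \<subseteq> {c. Re c \<le> 0} \<and> mat_exp M = A"
proof -
  let ?n = "CARD('n) - u"
  obtain X where X: "\<And>t. 0 \<le> t \<Longrightarrow> (B has_vector_derivative B t ** X) (at t within {0..})"
    using matrix_semigroup_generator[OF B] by blast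
  \<comment> \<open>A basis vector of the first block is an eigenvector of \<open>B 1\<close> with
    unimodular eigenvalue. As \<open>B t\<close> commutes with \<open>B 1\<close>, its image is
    again in that eigenspace and has zero tail.\<close>
  have low: "B t $h e (u + i) $h e j = 0" if t: "0 \<le> t" and i: "i < ?n" and j: "j < u" for t i j
  proof -
    let ?x = "axis (e j) 1 :: complex^'n"
    have "split_map e u \<Lambda> A ?x = \<Lambda> $$ (j,j) *s ?x"
    proof (rule coord_vec_eqI)
      fix i assume "i < u"
      then show "split_map e u \<Lambda> A ?x $h e i = (\<Lambda> $$ (j,j) *s ?x) $h e i"
        using u j by (simp add: split_map_first[OF \<Lambda>(1,2)] axis_def coord_inj)
    next
      fix i assume i: "i < ?n"
      have "coords_tail e u ?x = 0\<^sub>v ?n"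
        using j u by (intro eq_vecI) (auto simp: coords_tail_def axis_def coord_inj)
      then have "(A *\<^sub>v coords_tail e u ?x) $ i = 0" using A(1) i by simp
      then show "split_map e u \<Lambda> A ?x $h e (u + i) = (\<Lambda> $$ (j,j) *s ?x) $h e (u + i)"
        using u j i by (simp add: split_map_last[OF \<Lambda>(1) A(1)] axis_def coord_inj del: index_mult_mat_vec)
    qed
    then have "B 1 *v ?x = \<Lambda> $$ (j,j) *s ?x" by (simp add: B1)
    moreover have "B 1 ** B t = B t ** B 1" using B(2)[of 1 t] B(2)[of t 1] t by (simp add: add.commute)
    ultimately have "B 1 *v (B t *v ?x) = \<Lambda> $$ (j,j) *s (B t *v ?x)"
      by (simp add: matrix_vector_mul_assoc) (simp add: matrix_vector_mul_assoc[symmetric] vector_scalar_commute)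
    then have "(B t *v ?x) $h e (u + i) = 0"
      using unitary_diagonal_norm[OF \<Lambda> j] i
      by (intro split_map_eigenvector_tail[OF \<Lambda>(1) A]) (auto simp: B1)
    then show ?thesis by (simp add: matrix_entry)
  qed
  define D where "D t = Matrix.mat ?n ?n (\<lambda>(i,j). B t $h e (u + i) $h e (u + j))" for t
  define M where "M = Matrix.mat ?n ?n (\<lambda>(i,j). X $h e (u + i) $h e (u + j))"
  have M: "M \<in> carrier_mat ?n ?n" by (simp add: M_def)
  have D: "D t \<in> carrier_mat ?n ?n" for t by (simp add: D_def)
  have D': "((\<lambda>t. D t $$ (i,j)) has_vector_derivative (D t * M) $$ (i,j)) (at t within {0..})"
    if t: "0 \<le> t" and ij: "i < ?n" "j < ?n" for t i j
  proof -
    have "((\<lambda>t. B t $h e (u + i) $h e (u + j)) has_vector_derivative (B t ** X) $h e (u + i) $h e (u + j))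
        (at t within {0..})"
      by (intro bounded_linear.has_vector_derivative[OF bounded_linear_vec_nth] X[OF t])
    \<comment> \<open>The term of the product running through the first block contains the vanishing
      lower left block of \<open>B t\<close>, so only the product of the lower right blocks
      remains.\<close>
    moreover have "(B t ** X) $h e (u + i) $h e (u + j) = (D t * M) $$ (i,j)"
      unfolding index_mult_mat_sum[OF D M ij]
      using t ij low by (simp add: matrix_matrix_mult_def sum_split_coords D_def M_def)
    ultimately show ?thesis using ij by (simp add: D_def)
  qed
  have D0: "D 0 = 1\<^sub>m ?n"
    using u by (intro eq_matI) (auto simp: D_def B(1) Finite_Cartesian_Product.mat_def coord_inj)
  have "D 1 = A"
  proof (rule eq_matI)
    fix i j assume "i < dim_row A" "j < dim_col A"
    then have ij: "i < ?n" "j < ?n" using A(1) by auto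
    have "D 1 $$ (i,j) = split_map e u \<Lambda> A (axis (e (u + j)) 1) $h e (u + i)"
      using ij by (simp add: D_def matrix_entry B1)
    also have "\<dots> = (\<Sum>l<?n. A $$ (i,l) * (if l = j then 1 else 0))"
      unfolding split_map_last[OF \<Lambda>(1) A(1) ij(1)] index_mult_mat_vec_sum[OF A(1) coords_tail_carrier ij(1)]
      using ij u by (intro sum.cong) (auto simp: axis_def coord_inj)
    also have "\<dots> = A $$ (i,j)" using ij by (simp add: if_distrib cong: if_cong)
    finally show "D 1 $$ (i,j) = A $$ (i,j)" .
  qed (use A(1) in \<open>auto simp: D_def\<close>)
  moreover have "D 1 = mat_exp M" by (rule ode_mat_exp_unique[OF M D D' D0])
  ultimately have exp: "mat_exp M = A" by simp
  have diss: "dissipative M"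
    unfolding dissipative_def
  proof (intro conjI ballI)
    show "square_mat M" by (simp add: M_def)
    fix w :: "complex Matrix.vec" assume "w \<in> carrier_vec (dim_row M)"
    then have w: "w \<in> carrier_vec ?n" by (simp add: M_def)
    \<comment> \<open>Padding \<open>w\<close> with zeros makes the quadratic form of the full
      generator at \<open>z\<close> equal to that of its block \<open>M\<close> at
      \<open>w\<close>.\<close>
    define z where "z = of_coords e (0\<^sub>v u @\<^sub>v w)"
    have z: "z $h e i = 0" if "i < u" for i using that u w by (simp add: z_def of_coords_index)
    have z': "z $h e (u + j) = w $ j" if "j < ?n" for j using that u w by (simp add: z_def of_coords_index)
    have "herm (X *v z) z = (\<Sum>i<?n. (\<Sum>l<?n. M $$ (i,l) * w $ l) * cnj (w $ i))"
      by (simp add: herm_def sum_split_coords z z' matrix_vector_mult_def M_def)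
    also have "\<dots> = (M *\<^sub>v w) \<bullet>c w"
      unfolding cscalar_prod_sum[OF mult_mat_vec_carrier[OF M w] w]
      by (intro sum.cong refl) (simp add: index_mult_mat_vec_sum[OF M w] del: index_mult_mat_vec)
    finally have "(M *\<^sub>v w) \<bullet>c w = herm (X *v z) z" ..
    moreover have "(B has_vector_derivative X) (at 0 within {0..})" using X[of 0] B(1) by simp
    then have "Re (herm (X *v z) z) \<le> 0"
      using contraction_generator_dissipative[where B = B and X = X and w = z] B(1,4) by simp
    ultimately show "Re ((M *\<^sub>v w) \<bullet>c w) \<le> 0" by simp
  qed
  show ?thesis
    by (rule bexI[OF _ M], intro conjI diss exp dissipative_spectrum[OF M diss])
qed

end

section \<open>Contractive block maps and the flow of a dissipative matrix\<close>

lemma spectral_norm_contraction: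
  assumes A: "A \<in> carrier_mat n n" "spectral_norm A \<le> 1" and v: "v \<in> carrier_vec n"
  shows "(\<Sum>i<n. (cmod ((A *\<^sub>v v) $ i))\<^sup>2) \<le> (\<Sum>i<n. (cmod (v $ i))\<^sup>2)"
proof -
  have sq: "(vec_norm2 w)\<^sup>2 = (\<Sum>i<n. (cmod (w $ i))\<^sup>2)" if "w \<in> carrier_vec n" for w
    using that by (auto simp: vec_norm2_def L2_set_def sum_nonneg)
  have Aw: "A *\<^sub>v w \<in> carrier_vec n" for w by (rule carrier_vecI) (use A(1) in auto)
  let ?S = "{vec_norm2 (A *\<^sub>v w) | w. w \<in> carrier_vec (dim_col A) \<and> vec_norm2 w \<le> 1}"
  \<comment> \<open>A real \<open>Sup\<close> bounds its set only if the set is bounded above; the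
    sum of the entry moduli is such a bound.\<close>
  have "bdd_above ?S"
  proof (rule bdd_aboveI)
    fix r assume "r \<in> ?S"
    then obtain w where w: "r = vec_norm2 (A *\<^sub>v w)" "w \<in> carrier_vec n" "vec_norm2 w \<le> 1"
      using A(1) by auto
    have w1: "cmod (w $ j) \<le> 1" if "j < n" for j
      using member_le_L2_set[of "{..<dim_vec w}" j "\<lambda>i. cmod (w $ i)"] that w by (auto simp: vec_norm2_def)
    have "r \<le> (\<Sum>i<n. cmod ((A *\<^sub>v w) $ i))"
      unfolding w(1) vec_norm2_def using A(1) L2_set_le_sum[of "{..<n}" "\<lambda>i. cmod ((A *\<^sub>v w) $ i)"]
      by (simp del: index_mult_mat_vec)
    also have "\<dots> \<le> (\<Sum>i<n. \<Sum>j<n. cmod (A $$ (i,j)))"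
    proof (rule sum_mono)
      fix i assume "i \<in> {..<n}"
      then have i: "i < n" by simp
      show "cmod ((A *\<^sub>v w) $ i) \<le> (\<Sum>j<n. cmod (A $$ (i,j)))"
        unfolding index_mult_mat_vec_sum[OF A(1) w(2) i]
        by (rule sum_norm_le) (simp add: norm_mult mult_left_le w1)
    qed
    finally show "r \<le> (\<Sum>i<n. \<Sum>j<n. cmod (A $$ (i,j)))" .
  qed
  then have le: "vec_norm2 (A *\<^sub>v w) \<le> 1" if "w \<in> carrier_vec n" "vec_norm2 w \<le> 1" for w
    using cSup_upper[of "vec_norm2 (A *\<^sub>v w)" ?S] A that unfolding spectral_norm_def by fastforce
  have "vec_norm2 (A *\<^sub>v v) \<le> vec_norm2 v"
  proof (cases "vec_norm2 v = 0")
    case True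
    then have "\<forall>i<n. v $ i = 0" using sq[OF v] by (simp add: sum_nonneg_eq_0_iff)
    then have "(A *\<^sub>v v) $ i = 0" if "i < n" for i
      by (simp add: index_mult_mat_vec_sum[OF A(1) v that] del: index_mult_mat_vec)
    then have "(vec_norm2 (A *\<^sub>v v))\<^sup>2 = 0" unfolding sq[OF Aw] by simp
    then show ?thesis using True by simp
  next
    case False
    have n0: "vec_norm2 x \<ge> 0" for x by (simp add: vec_norm2_def L2_set_nonneg)
    have scale: "vec_norm2 (of_real c \<cdot>\<^sub>v x) = c * vec_norm2 x" if "c \<ge> 0" for c x
      using that by (auto simp: vec_norm2_def norm_mult L2_set_right_distrib intro!: L2_set_cong)
    define c where "c = 1 / vec_norm2 v"
    have c: "c > 0" using False n0[of v] by (simp add: c_def)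
    have "vec_norm2 (of_real c \<cdot>\<^sub>v v) = 1"
      unfolding scale[OF less_imp_le[OF c]] using False by (simp add: c_def)
    then have "vec_norm2 (A *\<^sub>v (of_real c \<cdot>\<^sub>v v)) \<le> 1" using v by (intro le) auto
    also have "A *\<^sub>v (of_real c \<cdot>\<^sub>v v) = of_real c \<cdot>\<^sub>v (A *\<^sub>v v)"
      using A(1) v by (rule mult_mat_vec)
    finally show ?thesis
      unfolding scale[OF less_imp_le[OF c]] using False n0[of v] by (simp add: c_def divide_le_eq)
  qed
  then have "(vec_norm2 (A *\<^sub>v v))\<^sup>2 \<le> (vec_norm2 v)\<^sup>2"
    by (rule power_mono) (simp add: vec_norm2_def L2_set_nonneg)
  then show ?thesis by (simp only: sq[OF v] sq[OF Aw])
qed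

context
  fixes e :: "nat \<Rightarrow> 'n::finite" and u :: nat
  assumes e: "bij_betw e {..<CARD('n)} UNIV" and u: "u \<le> CARD('n)"
begin

lemma split_map_contraction:
  assumes \<Lambda>: "\<Lambda> \<in> carrier_mat u u" "diagonal_mat \<Lambda>" "\<And>i. i < u \<Longrightarrow> cmod (\<Lambda> $$ (i,i)) = 1"
    and A: "A \<in> carrier_mat (CARD('n) - u) (CARD('n) - u)"
    and contr: "\<And>v. v \<in> carrier_vec (CARD('n) - u) \<Longrightarrow>
      (\<Sum>i<CARD('n) - u. (cmod ((A *\<^sub>v v) $ i))\<^sup>2) \<le> (\<Sum>i<CARD('n) - u. (cmod (v $ i))\<^sup>2)"
  shows "norm (split_map e u \<Lambda> A z) \<le> norm z"
proof (rule power2_le_imp_le)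
  have sq: "(norm w)\<^sup>2 = (\<Sum>i<u. (cmod (w $h e i))\<^sup>2) + (\<Sum>j<CARD('n) - u. (cmod (w $h e (u + j)))\<^sup>2)"
    for w :: "complex^'n"
    using sum_split_coords[OF e u, of "\<lambda>k. (cmod (w $h k))\<^sup>2"]
    by (simp add: norm_vec_def L2_set_def sum_nonneg)
  show "(norm (split_map e u \<Lambda> A z))\<^sup>2 \<le> (norm z)\<^sup>2"
    unfolding sq using contr[OF coords_tail_carrier, of e z]
    by (simp add: split_map_first[OF e u \<Lambda>(1,2)] split_map_last[OF e u \<Lambda>(1) A] norm_mult \<Lambda>(3)
        coords_tail_index del: index_mult_mat_vec)
qed simp

lemma dissipative_flow:
  assumes \<Lambda>: "\<Lambda> \<in> carrier_mat u u" "diagonal_mat \<Lambda>" "unitary_mat \<Lambda>"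
    and M: "M \<in> carrier_mat (CARD('n) - u) (CARD('n) - u)" "dissipative M"
  obtains L :: "real \<Rightarrow> complex^'n^'n" where "continuous_on UNIV L" "\<And>z. L 0 *v z = z"
    "\<And>t s z. 0 \<le> t \<Longrightarrow> L (t + s) *v z = L t *v (L s *v z)"
    "\<And>t z. 0 \<le> t \<Longrightarrow> norm (L t *v z) \<le> norm z" "\<And>z. L 1 *v z = split_map e u \<Lambda> (mat_exp M) z"
proof -
  let ?n = "CARD('n) - u"
  \<comment> \<open>Any choice of arguments gives a one-parameter group
    \<open>cis (t * \<theta> i)\<close> through \<Lambda> at time 1; for non-integral times the
    powers of \<Lambda> depend on the branch, but no compatibility between branches is
    required.\<close>
  have "\<forall>i. \<exists>\<theta>. i < u \<longrightarrow> \<Lambda> $$ (i,i) = cis \<theta>"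
  proof
    fix i
    show "\<exists>\<theta>. i < u \<longrightarrow> \<Lambda> $$ (i,i) = cis \<theta>"
    proof (cases "i < u")
      case True
      then have "rcis 1 (Arg (\<Lambda> $$ (i,i))) = \<Lambda> $$ (i,i)"
        using rcis_cmod_Arg[of "\<Lambda> $$ (i,i)"] unitary_diagonal_norm[OF \<Lambda>] by simp
      then show ?thesis by (metis cis_rcis_eq)
    qed simp
  qed
  then obtain \<theta> where \<theta>: "\<And>i. i < u \<Longrightarrow> \<Lambda> $$ (i,i) = cis (\<theta> i)" by metis
  define D where "D t = Matrix.mat u u (\<lambda>(i,j). if i = j then cis (t * \<theta> i) else 0)" for t
  have D: "D t \<in> carrier_mat u u" "diagonal_mat (D t)" for t by (auto simp: D_def diagonal_mat_def)
  define E where "E t = mat_exp (of_real t \<cdot>\<^sub>m M)" for t :: real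
  have E: "E t \<in> carrier_mat ?n ?n" for t using M(1) by (simp add: E_def)
  have "\<forall>t. \<exists>L. \<forall>z. split_map e u (D t) (E t) z = L *v z"
    using split_map_matrix[OF e u D E] by metis
  then obtain L where L: "\<And>t z. L t *v z = split_map e u (D t) (E t) z" by metis
  have first: "(L t *v z) $h e i = cis (t * \<theta> i) * z $h e i" if "i < u" for t z i
    using split_map_first[OF e u D that, of t "E t" z] that by (simp add: L D_def)
  have last: "(L t *v z) $h e (u + j) = (E t *\<^sub>v coords_tail e u z) $ j" if "j < ?n" for t z j
    unfolding L by (rule split_map_last[OF e u D(1) E that])
  have E0: "E 0 = 1\<^sub>m ?n" using mat_exp_0[OF M(1)] by (simp add: E_def)
  have E1: "E 1 = mat_exp M" using smult_one[OF M(1)] by (simp add: E_def)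
  show ?thesis
  proof (rule that[of L])
    show "L 0 *v z = z" for z
      by (rule coord_vec_eqI[OF e u]) (simp_all add: first last E0 one_mult_mat_vec[OF coords_tail_carrier] del: index_mult_mat_vec)
    show "L (t + s) *v z = L t *v (L s *v z)" if t: "0 \<le> t" for t s z
    proof (rule coord_vec_eqI[OF e u])
      show "(L (t + s) *v z) $h e i = (L t *v (L s *v z)) $h e i" if "i < u" for i
        using that by (simp add: first distrib_right cis_mult[symmetric])
      have "coords_tail e u (L s *v z) = E s *\<^sub>v coords_tail e u z"
        using E[of s] by (intro eq_vecI) (auto simp: coords_tail_index last coords_tail_def)
      moreover have "E (t + s) = E t * E s" unfolding E_def using mat_exp_add[OF M(1) t] .
      ultimately show "(L (t + s) *v z) $h e (u + j) = (L t *v (L s *v z)) $h e (u + j)" if "j < ?n" for j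
        using that by (simp add: last assoc_mult_mat_vec[OF E E coords_tail_carrier] del: index_mult_mat_vec)
    qed
    show "norm (L t *v z) \<le> norm z" if t: "0 \<le> t" for t z
      unfolding L
    proof (rule split_map_contraction[OF D _ E])
      show "cmod (D t $$ (i,i)) = 1" if "i < u" for i using that by (simp add: D_def)
      show "(\<Sum>i<?n. (cmod ((E t *\<^sub>v v) $ i))\<^sup>2) \<le> (\<Sum>i<?n. (cmod (v $ i))\<^sup>2)"
        if "v \<in> carrier_vec ?n" for v
        unfolding E_def by (rule mat_exp_contraction[OF M that t])
    qed
    show "L 1 *v z = split_map e u \<Lambda> (mat_exp M) z" for z
      using E[of 1] unfolding E1
      by (intro coord_vec_eqI[OF e u])
         (simp_all add: first last E1 \<theta> split_map_first[OF e u \<Lambda>(1,2)] split_map_last[OF e u \<Lambda>(1)]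
           del: index_mult_mat_vec)
    have entry: "continuous_on UNIV (\<lambda>t. L t $h k $h l)" for k l
    proof -
      have Ec: "continuous_on UNIV (\<lambda>t. E t $$ (i,j))" if "i < ?n" "j < ?n" for i j
        unfolding E_def using mat_exp_derivative(1)[OF M(1) that, of _ UNIV]
        by (intro continuous_at_imp_continuous_on ballI) (meson has_vector_derivative_continuous)
      show ?thesis
        unfolding matrix_entry
      proof (rule coord_cases[OF e u, of k])
        fix i assume i: "i < u" "k = e i"
        show "continuous_on UNIV (\<lambda>t. (L t *v axis l 1) $h k)"
          unfolding i(2) first[OF i(1)] cis_conv_exp by (intro continuous_intros)
      next
        fix j assume j: "j < ?n" "k = e (u + j)"
        have eq: "(\<lambda>t. (L t *v axis l 1) $h k) = (\<lambda>t. \<Sum>m<?n. E t $$ (j,m) * coords_tail e u (axis l 1) $ m)"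
          unfolding j(2) last[OF j(1)] index_mult_mat_vec_sum[OF E coords_tail_carrier j(1)] ..
        show "continuous_on UNIV (\<lambda>t. (L t *v axis l 1) $h k)"
          unfolding eq by (intro continuous_intros Ec j(1)) simp
      qed
    qed
    have "continuous_on UNIV (\<lambda>t. \<chi> k l. L t $h k $h l)"
      by (intro continuous_on_vec_lambda entry)
    then show "continuous_on UNIV L" by simp
  qed
qed

end


subsection \<open>Conjugation of linear semigroups\<close>

lemma semigroup_on_conjugate_linear:
  fixes L :: "real \<Rightarrow> complex^'n^'n"
  assumes \<sigma>: "\<sigma> \<in> Hol (ball 0 1)" "\<tau> \<in> Hol (ball 0 1)"
      "\<And>z. z \<in> ball 0 1 \<Longrightarrow> \<tau> (\<sigma> z) = z" "\<And>z. z \<in> ball 0 1 \<Longrightarrow> \<sigma> (\<tau> z) = z"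
    and L: "continuous_on UNIV L" "\<And>z. L 0 *v z = z"
      "\<And>t s z. 0 \<le> t \<Longrightarrow> L (t + s) *v z = L t *v (L s *v z)"
      "\<And>t z. 0 \<le> t \<Longrightarrow> norm (L t *v z) \<le> norm z"
  shows "semigroup_on (ball 0 1) (\<lambda>t z. \<tau> (L t *v \<sigma> z))"
    and "0 \<le> t \<Longrightarrow> (\<lambda>z. \<tau> (L t *v \<sigma> z)) \<in> LFM"
proof -
  let ?\<Phi> = "\<lambda>t z. \<tau> (L t *v \<sigma> z)"
  have ball: "L t *v z \<in> ball 0 1" if "0 \<le> t" "z \<in> ball 0 1" for t z
    using L(4)[OF that(1), of z] that(2) by simp
  have LH: "(*v) (L t) \<in> Hol (ball 0 1)" if "0 \<le> t" for t
    using ball[OF that] lin_frac_holo[OF lin_frac_linear[of "(*v) (L t)" "L t"]] by (intro HolI) auto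
  have Hol: "?\<Phi> t \<in> Hol (ball 0 1)" if "0 \<le> t" for t
    by (rule Hol_compose[OF Hol_compose[OF \<sigma>(1) LH[OF that]] \<sigma>(2)])
  show "?\<Phi> t \<in> LFM" if t: "0 \<le> t" for t
  proof -
    have "lin_frac (\<lambda>z. L t *v \<sigma> z)"
      by (rule lin_frac_compose[OF automorphism_lin_frac[OF \<sigma>] HolD(2)[OF \<sigma>(1)] lin_frac_linear[OF refl]])
    then have "lin_frac (?\<Phi> t)"
      by (rule lin_frac_compose[OF _ ball[OF t HolD(2)[OF \<sigma>(1)]] automorphism_lin_frac[OF \<sigma>(2,1,4,3)]])
    with Hol[OF t] show ?thesis by (simp add: LFM_iff)
  qed
  have "continuous_map (top_of_set {0..}) (compact_open (ball 0 1)) ?\<Phi>"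
    unfolding compact_open_def
  proof (rule continuous_on_generated_topo)
    fix U assume "U \<in> {{f \<in> Hol (ball 0 1). f ` K \<subseteq> V} | K V. compact K \<and> K \<subseteq> ball (0 :: complex^'n) 1 \<and> open V}"
    then obtain K V where U: "U = {f \<in> Hol (ball 0 1). f ` K \<subseteq> V}" and K: "compact K" "K \<subseteq> ball (0 :: complex^'n) 1"
      and V: "open V" by auto
    have "continuous_on (K \<times> {0..}) (\<lambda>x. L (snd x) *v \<sigma> (fst x))"
      by (intro bounded_bilinear.continuous_on[OF bounded_bilinear_matrix_vector_mult]
          continuous_on_compose2[OF L(1)] continuous_on_compose2[OF holo_on_imp_continuous_on[OF HolD(1)[OF \<sigma>(1)]]]
          continuous_intros) (use K in auto)
    then have "continuous_on (K \<times> {0..}) (\<lambda>x. ?\<Phi> (snd x) (fst x))"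
      by (rule continuous_on_compose2[OF holo_on_imp_continuous_on[OF HolD(1)[OF \<sigma>(2)]]])
         (use K ball HolD(2)[OF \<sigma>(1)] in fastforce)
    \<comment> \<open>The times at which \<open>K\<close> leaves \<open>V\<close> are the projection
      of a closed set along the compact factor \<open>K\<close>, hence closed. Joint continuity in
      point and time thus gives continuity for the compact-open topology.\<close>
    then have "closedin (top_of_set (K \<times> {0..})) ((K \<times> {0..}) \<inter> (\<lambda>x. ?\<Phi> (snd x) (fst x)) -` (- V))"
      using V by (intro continuous_closedin_preimage) auto
    from closedin_compact_projection[OF K(1) this]
    have "openin (top_of_set {0..})
        ({0..} - {t. \<exists>z. z \<in> K \<and> (z, t) \<in> (K \<times> {0..}) \<inter> (\<lambda>x. ?\<Phi> (snd x) (fst x)) -` (- V)})"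
      by (rule openin_diff[OF openin_subtopology_self])
    moreover have "\<dots> = ?\<Phi> -` U \<inter> topspace (top_of_set {0..})"
      using Hol by (auto simp: U)
    ultimately show "openin (top_of_set {0..}) (?\<Phi> -` U \<inter> topspace (top_of_set {0..}))" by simp
  next
    \<comment> \<open>With \<open>K\<close> empty the subbasic set is all of \<open>Hol\<close>, so
      the generating sets cover every holomorphic self-map.\<close>
    have "Hol (ball (0 :: complex^'n) 1) \<in> {{f \<in> Hol (ball 0 1). f ` K \<subseteq> V} | K V. compact K \<and> K \<subseteq> ball 0 1 \<and> open V}"
      by (intro CollectI exI[of _ "{}"] exI[of _ UNIV]) auto
    then show "?\<Phi> ` topspace (top_of_set {0..}) \<subseteq>
        \<Union> {{f \<in> Hol (ball 0 1). f ` K \<subseteq> V} | K V. compact K \<and> K \<subseteq> ball 0 1 \<and> open V}"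
      using Hol by auto
  qed
  then show "semigroup_on (ball 0 1) ?\<Phi>"
    unfolding semigroup_on_def o_def
    using Hol \<sigma>(3) L(2,3) \<sigma>(4)[OF ball[OF _ HolD(2)[OF \<sigma>(1)]]] by auto
qed

theorem theorem1p5:
  fixes \<phi> \<psi> :: "complex^'n \<Rightarrow> complex^'n"
    and e :: "nat \<Rightarrow> 'n" and u :: nat
    and \<Lambda> A\<^sub>1 :: "complex mat"
  assumes e: "bij_betw e {..<CARD('n)} UNIV"
    and u: "1 \<le> u" "u \<le> CARD('n)"
    and \<phi>: "\<phi> \<in> LFM" "elliptic \<phi>"
    and \<Lambda>: "\<Lambda> \<in> carrier_mat u u" "diagonal_mat \<Lambda>" "unitary_mat \<Lambda>"
    and A\<^sub>1: "A\<^sub>1 \<in> carrier_mat (CARD('n) - u) (CARD('n) - u)" "rho A\<^sub>1 < 1" "spectral_norm A\<^sub>1 \<le> 1"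
    and \<psi>: "\<forall>z\<in>ball 0 1. \<psi> z = split_map e u \<Lambda> A\<^sub>1 z"
    and conj: "conjugated \<phi> (ball 0 1) \<psi> (ball 0 1)"
  shows "(\<exists>\<Phi> :: real \<Rightarrow> complex^'n \<Rightarrow> complex^'n.
            semigroup_on (ball 0 1) \<Phi> \<and> (\<forall>t\<ge>0. \<Phi> t \<in> LFM) \<and> (\<forall>z\<in>ball 0 1. \<Phi> 1 z = \<phi> z))
         \<longleftrightarrow>
         (\<exists>M \<in> carrier_mat (CARD('n) - u) (CARD('n) - u).
            dissipative M \<and> spectrum M \<subseteq> {c. Re c \<le> 0} \<and> mat_exp M = A\<^sub>1)"
    (is "?semigroup \<longleftrightarrow> ?generator")
proof -
  let ?D = "ball (0 :: complex^'n) 1"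
  obtain \<sigma> where bih: "biholomorphic \<sigma> ?D ?D" and \<phi>\<sigma>: "\<And>z. z \<in> ?D \<Longrightarrow> \<phi> z = inv_into ?D \<sigma> (\<psi> (\<sigma> z))"
    using conj by (auto simp: conjugated_def)
  define \<tau> where "\<tau> = inv_into ?D \<sigma>"
  note \<sigma> = biholomorphic_inverse[OF bih, folded \<tau>_def]
  have \<psi>D: "\<psi> z \<in> ?D" if "z \<in> ?D" for z
  proof -
    have "norm (split_map e u \<Lambda> A\<^sub>1 z) \<le> norm z"
      by (rule split_map_contraction[OF e u(2) \<Lambda>(1,2) unitary_diagonal_norm[OF \<Lambda>] A\<^sub>1(1)
            spectral_norm_contraction[OF A\<^sub>1(1,3)]])
    with \<psi> that show ?thesis by simp
  qed
  obtain L where L: "\<And>z. split_map e u \<Lambda> A\<^sub>1 z = L *v z"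
    using split_map_matrix[OF e u(2) \<Lambda>(1,2) A\<^sub>1(1)] by blast
  show ?thesis
  proof
    assume ?semigroup
    then obtain \<Phi> where \<Phi>: "semigroup_on ?D \<Phi>" and \<Phi>1: "\<And>z. z \<in> ?D \<Longrightarrow> \<Phi> 1 z = \<phi> z" by blast
    obtain a where "a \<in> ?D" "\<phi> a = a" using \<phi>(2) by (auto simp: elliptic_def)
    then obtain q where q: "q \<in> ?D" "\<And>t. 0 \<le> t \<Longrightarrow> \<Phi> t q = q"
      using semigroup_on_common_fixed_point[OF \<Phi>, of a] \<Phi>1 by metis
    define p where "p = \<sigma> q"
    have p: "p \<in> ?D" using HolD(2)[OF \<sigma>(1) q(1)] by (simp add: p_def)
    have "\<tau> (\<psi> p) = q" using q(2)[of 1] \<Phi>1[OF q(1)] \<phi>\<sigma>[OF q(1)] by (simp add: p_def \<tau>_def)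
    then have \<psi>p: "\<psi> p = p" using \<sigma>(4)[OF \<psi>D[OF p]] by (simp add: p_def)
    then have Lp: "L *v p = p" using \<psi> p L by simp
    \<comment> \<open>A fixed point \<open>p\<close> has zero tail, and
      \<open>\<Lambda> $$ (i,i) = 1\<close> wherever \<open>p $h e i\<close> is nonzero; coordinates
      on which \<open>L\<close> differs from the identity do not meet \<open>p\<close>.\<close>
    have Lp': "herm (L *v z) p = herm z p" for z
    proof -
      have "p $h e (u + j) = 0" if "j < CARD('n) - u" for j
        using split_map_eigenvector_tail[OF e u(2) \<Lambda>(1) A\<^sub>1(1,2), of p 1 j] that Lp L by simp
      moreover have "\<Lambda> $$ (i,i) * z $h e i * cnj (p $h e i) = z $h e i * cnj (p $h e i)" if "i < u" for i
        using split_map_first[OF e u(2) \<Lambda>(1,2) that, of A\<^sub>1 p] Lp L by (cases "p $h e i = 0") auto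
      ultimately show ?thesis
        unfolding L[symmetric]
        by (auto simp: herm_def sum_split_coords[OF e u(2)] split_map_first[OF e u(2) \<Lambda>(1,2)]
            intro!: sum.cong)
    qed
    define S where "S z = ball_moebius p (\<sigma> z)" for z
    define R where "R z = \<tau> (ball_moebius p z)" for z
    have S: "S \<in> Hol ?D" "S q = 0" and R: "R \<in> Hol ?D" "R 0 = q"
      unfolding S_def R_def using Hol_compose[OF \<sigma>(1) ball_moebius_Hol[OF p]] Hol_compose[OF ball_moebius_Hol[OF p] \<sigma>(2)]
        ball_moebius_self[OF p] \<sigma>(3)[OF q(1)] by (simp_all add: p_def)
    have SR: "S (R z) = z" if "z \<in> ?D" for z
      unfolding S_def R_def using \<sigma>(4)[OF ball_moebius_in_ball[OF p that]] ball_moebius_ball_moebius[OF p that] by simp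
    \<comment> \<open>Because \<open>L\<close> commutes with the involution at \<open>p\<close>,
      recentring reproduces \<open>L\<close> itself and not merely a conjugate, so the lower right
      block is still \<open>A\<^sub>1\<close>.\<close>
    have lin: "S (\<Phi> 1 (R z)) = L *v z" if z: "z \<in> ?D" for z
    proof -
      note m = ball_moebius_in_ball[OF p z]
      have "S (\<Phi> 1 (R z)) = ball_moebius p (\<sigma> (\<tau> (\<psi> (\<sigma> (R z)))))"
        using HolD(2)[OF R(1) z] by (simp add: S_def \<Phi>1 \<phi>\<sigma> \<tau>_def)
      also have "\<sigma> (R z) = ball_moebius p z" unfolding R_def by (rule \<sigma>(4)[OF m])
      also have "\<sigma> (\<tau> (\<psi> (ball_moebius p z))) = L *v ball_moebius p z" using \<sigma>(4)[OF \<psi>D[OF m]] \<psi> m L by simp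
      also have "ball_moebius p \<dots> = L *v z" by (simp only: ball_moebius_commute[OF Lp Lp'] ball_moebius_ball_moebius[OF p z])
      finally show ?thesis .
    qed
    obtain B :: "real \<Rightarrow> complex^'n^'n" where B: "B 0 = Imat" "\<And>t s. 0 \<le> t \<Longrightarrow> 0 \<le> s \<Longrightarrow> B (t + s) = B t ** B s"
      "(B \<longlongrightarrow> Imat) (at_right 0)" "\<And>t z. 0 \<le> t \<Longrightarrow> norm (B t *v z) \<le> norm z" "B 1 = L"
      using semigroup_on_linearization[OF \<Phi> q S R SR lin] by blast
    show ?generator
      by (rule generator_of_split_map[OF e u(2) \<Lambda> A\<^sub>1(1,2) B(1-4)]) (simp_all add: B(5) L)
  next
    assume ?generator
    then obtain M where M: "M \<in> carrier_mat (CARD('n) - u) (CARD('n) - u)" "dissipative M" and exp: "mat_exp M = A\<^sub>1"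
      by blast
    obtain F :: "real \<Rightarrow> complex^'n^'n" where F: "continuous_on UNIV F" "\<And>z. F 0 *v z = z"
      "\<And>t s z. 0 \<le> t \<Longrightarrow> F (t + s) *v z = F t *v (F s *v z)"
      "\<And>t z. 0 \<le> t \<Longrightarrow> norm (F t *v z) \<le> norm z" and F1: "\<And>z. F 1 *v z = split_map e u \<Lambda> A\<^sub>1 z"
      using dissipative_flow[OF e u(2) \<Lambda> M] unfolding exp by blast
    note C = semigroup_on_conjugate_linear[OF \<sigma> F]
    have "\<tau> (F 1 *v \<sigma> z) = \<phi> z" if "z \<in> ?D" for z
      using \<phi>\<sigma>[OF that] \<psi> HolD(2)[OF \<sigma>(1) that] by (simp add: F1 \<tau>_def)
    with C show ?semigroup by (intro exI[of _ "\<lambda>t z. \<tau> (F t *v \<sigma> z)"]) blast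
  qed
qed

end
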